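(* Let $H$ be a separable infinite-dimensional Hilbert space. Consider the following two properties of a $C_0$-semigroup $T(\cdot)$ on $H$: (1) there exists a (measurable) set $M\subset\mathbb{R}_+$ with density $1$ such that $\lim_{t\to\infty,\,t\in M}T(t)=0$ weakly; (2) for every $\lambda\in\Gamma$ there exists a sequence $\{t_j^{(\lambda)}\}_{j=1}^\infty\subset\mathbb{R}_+$ with $\lim_{j\to\infty}t_j^{(\lambda)}=\infty$ such that $\lim_{j\to\infty}T(t_j^{(\lambda)})=\lambda I$ strongly. Then the set of all $C_0$-semigroups satisfying (1) and (2) is residual in the set $\mathcal{I}^{\mathrm{cont}}$ of all isometric $C_0$-semigroups on $H$ for the topology of strong convergence uniform on compact time intervals in $\mathbb{R}_+$. Likewise, the set of all unitary $C_0$-groups satisfying (1) and (2) is residual in the set $\mathcal{U}^{\mathrm{cont}}$ of all unitary $C_0$-groups on $H$ for the topology of strong convergence uniform on compact time intervals in $\mathbb{R}$.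
   Context: $H$ is a complex Hilbert space, $I$ is the identity operator on $H$, $\Gamma=\{z\in\mathbb{C}:|z|=1\}$, $\mathbb{R}_+=[0,\infty)$. A $C_0$-semigroup (resp. $C_0$-group) is a strongly continuous one-parameter semigroup $(T(t))_{t\ge0}$ (resp. group $(T(t))_{t\in\mathbb{R}}$) of bounded linear operators; it is isometric (resp. unitary) if every $T(t)$ is isometric (resp. unitary). The topologies are those of the complete metrizable spaces in which $T_m(\cdot)\to T(\cdot)$ means: for every $x\in H$, $\|T_m(t)x-T(t)x\|\to0$ uniformly for $t$ in compact subintervals of $\mathbb{R}_+$ (for $\mathcal{I}^{\mathrm{cont}}$), respectively of $\mathbb{R}$ (for $\mathcal{U}^{\mathrm{cont}}$). A subset of such a space is residual if its complement is of first category, i.e. a countable union of nowhere dense sets. Weak (strong) convergence of operators means convergence in the weak (strong) operator topology. The density of a measurable set $M\subset\mathbb{R}_+$ is $d(M)=\lim_{t\to\infty}\frac{\mu(M\cap[0,t])}{t}$ whenever this limit exists, where $\mu$ is Lebesgue measure. *)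

theory Defs
  imports "HOL-Analysis.Analysis"
begin

text \<open>A complex inner product space is presented over its underlying real inner product space:
  the complex scalar multiplication extends the real one, and the complex inner product (linear in
  the first argument) has the real inner product as its real part. The norm and the topology are
  therefore those of \<^class>\<open>real_inner\<close>, with \<open>norm x = sqrt (Re (cinner x x))\<close>.\<close>

class complex_inner = real_inner +
  fixes scaleC :: "complex \<Rightarrow> 'a \<Rightarrow> 'a" (infixr "*\<^sub>C" 75)
    and cinner :: "'a \<Rightarrow> 'a \<Rightarrow> complex"
  assumes scaleC_add_right: "c *\<^sub>C (x + y) = c *\<^sub>C x + c *\<^sub>C y"
    and scaleC_add_left: "(c + d) *\<^sub>C x = c *\<^sub>C x + d *\<^sub>C x"
    and scaleC_scaleC: "c *\<^sub>C d *\<^sub>C x = (c * d) *\<^sub>C x"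
    and scaleC_of_real: "complex_of_real r *\<^sub>C x = r *\<^sub>R x"
    and cinner_add_left: "cinner (x + y) z = cinner x z + cinner y z"
    and cinner_scaleC_left: "cinner (c *\<^sub>C x) y = c * cinner x y"
    and cinner_commute: "cinner x y = cnj (cinner y x)"
    and inner_eq_Re_cinner: "inner x y = Re (cinner x y)"

class complex_hilbert = complex_inner + complete_space

lemma vector_space_scaleC: "vector_space (scaleC :: complex \<Rightarrow> 'a \<Rightarrow> 'a::complex_inner)"
  using scaleC_of_real[of 1]
  by unfold_locales (simp_all add: scaleC_add_right scaleC_add_left scaleC_scaleC)

lemma cinner_self: "cinner x x = complex_of_real ((norm x)\<^sup>2)"
  using cinner_commute[of x x] inner_eq_Re_cinner[of x x]
  by (simp add: complex_eq_iff power2_norm_eq_inner)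

definition finite_dim :: "'a::complex_inner itself \<Rightarrow> bool" where
  "finite_dim _ \<longleftrightarrow> (\<exists>B::'a set. finite B \<and> module.span scaleC B = UNIV)"


definition bounded_clinear :: "('a::complex_inner \<Rightarrow> 'a) \<Rightarrow> bool" where
  "bounded_clinear A \<longleftrightarrow> bounded_linear A \<and> (\<forall>c x. A (c *\<^sub>C x) = c *\<^sub>C A x)"

definition isometric :: "('a::complex_inner \<Rightarrow> 'a) \<Rightarrow> bool" where
  "isometric A \<longleftrightarrow> (\<forall>x. norm (A x) = norm x)"

definition adjoint_of :: "('a::complex_inner \<Rightarrow> 'a) \<Rightarrow> ('a \<Rightarrow> 'a) \<Rightarrow> bool" where
  "adjoint_of A B \<longleftrightarrow> (\<forall>x y. cinner (A x) y = cinner x (B y))"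

definition unitary :: "('a::complex_inner \<Rightarrow> 'a) \<Rightarrow> bool" where
  "unitary U \<longleftrightarrow> bounded_clinear U \<and> (\<exists>V. adjoint_of U V \<and> V \<circ> U = id \<and> U \<circ> V = id)"


text \<open>Semigroups are indexed by \<open>{0..}\<close>; \<^const>\<open>extensional\<close> fixes the irrelevant values at
  negative arguments, so that different elements are different semigroups.\<close>

definition C0_semigroup :: "(real \<Rightarrow> 'a::complex_inner \<Rightarrow> 'a) \<Rightarrow> bool" where
  "C0_semigroup T \<longleftrightarrow>
     T \<in> extensional {0..} \<and>
     (\<forall>t\<ge>0. bounded_clinear (T t)) \<and>
     T 0 = id \<and>
     (\<forall>s\<ge>0. \<forall>t\<ge>0. T (s + t) = T s \<circ> T t) \<and>
     (\<forall>x. continuous_on {0..} (\<lambda>t. T t x))"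

definition C0_group :: "(real \<Rightarrow> 'a::complex_inner \<Rightarrow> 'a) \<Rightarrow> bool" where
  "C0_group T \<longleftrightarrow>
     (\<forall>t. bounded_clinear (T t)) \<and>
     T 0 = id \<and>
     (\<forall>s t. T (s + t) = T s \<circ> T t) \<and>
     (\<forall>x. continuous_on UNIV (\<lambda>t. T t x))"

definition isometric_semigroups :: "(real \<Rightarrow> 'a::complex_inner \<Rightarrow> 'a) set" where
  "isometric_semigroups = {T. C0_semigroup T \<and> (\<forall>t\<ge>0. isometric (T t))}"

definition unitary_groups :: "(real \<Rightarrow> 'a::complex_inner \<Rightarrow> 'a) set" where
  "unitary_groups = {T. C0_group T \<and> (\<forall>t. unitary (T t))}"


text \<open>The topology on a set \<open>X\<close> of operator families over the time set \<open>J\<close> of strong convergence,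
  uniform on compact subintervals of \<open>J\<close>.\<close>

definition strong_unif_topology ::
    "real set \<Rightarrow> (real \<Rightarrow> 'a::complex_inner \<Rightarrow> 'a) set \<Rightarrow> (real \<Rightarrow> 'a \<Rightarrow> 'a) topology" where
  "strong_unif_topology J X = topology_generated_by
     {{S \<in> X. \<forall>t\<in>{a..b}. norm (S t x - T t x) < e} |T x a b e.
        T \<in> X \<and> {a..b} \<subseteq> J \<and> 0 < e}"

abbreviation I_cont :: "(real \<Rightarrow> 'a::complex_inner \<Rightarrow> 'a) topology" where
  "I_cont \<equiv> strong_unif_topology {0..} isometric_semigroups"

abbreviation U_cont :: "(real \<Rightarrow> 'a::complex_inner \<Rightarrow> 'a) topology" where
  "U_cont \<equiv> strong_unif_topology UNIV unitary_groups"

lemma topspace_strong_unif_topology [simp]: "topspace (strong_unif_topology J X) = X"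
proof -
  have "S \<in> \<Union> {{S \<in> X. \<forall>t\<in>{a..b}. norm (S t x - T t x) < e} |T x a b e.
        T \<in> X \<and> {a..b} \<subseteq> J \<and> 0 < e}" if "S \<in> X" for S :: "real \<Rightarrow> 'a \<Rightarrow> 'a"
  proof -
    have "{R \<in> X. \<forall>t\<in>{1..0}. norm (R t 0 - S t 0) < 1}
        \<in> {{S \<in> X. \<forall>t\<in>{a..b}. norm (S t x - T t x) < e} |T x a b e.
            T \<in> X \<and> {a..b} \<subseteq> J \<and> 0 < e}"
      using that by (intro CollectI exI[of _ S] exI[of _ 0] exI[of _ "1::real"]) fastforce
    then show ?thesis
      using that by (intro UnionI) auto
  qed
  then show ?thesis
    unfolding strong_unif_topology_def topology_generated_by_topspace by blast
qed

lemma limitin_strong_unif_topology: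
  fixes X :: "(real \<Rightarrow> 'a::complex_inner \<Rightarrow> 'a) set"
  assumes cont: "\<And>S x. S \<in> X \<Longrightarrow> continuous_on J (\<lambda>t. S t x)"
  shows "limitin (strong_unif_topology J X) f T F \<longleftrightarrow>
    T \<in> X \<and> eventually (\<lambda>m. f m \<in> X) F \<and>
    (\<forall>x a b. {a..b} \<subseteq> J \<longrightarrow> uniform_limit {a..b} (\<lambda>m t. f m t x) (\<lambda>t. T t x) F)"
    (is "?L \<longleftrightarrow> ?R")
proof
  assume L: ?L
  then have TX: "T \<in> X"
    by (metis limitin_def topspace_strong_unif_topology)
  have ev: "eventually (\<lambda>m. f m \<in> X) F"
    using L unfolding limitin_def by (metis openin_topspace topspace_strong_unif_topology)
  have "uniform_limit {a..b} (\<lambda>m t. f m t x) (\<lambda>t. T t x) F" if ab: "{a..b} \<subseteq> J" for x a b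
  proof (rule uniform_limitI)
    fix e :: real assume e: "0 < e"
    let ?U = "{S \<in> X. \<forall>t\<in>{a..b}. norm (S t x - T t x) < e}"
    have "openin (strong_unif_topology J X) ?U"
      unfolding strong_unif_topology_def
      by (rule topology_generated_by_Basis) (use TX ab e in blast)
    moreover have "T \<in> ?U" using TX e by simp
    ultimately have "eventually (\<lambda>m. f m \<in> ?U) F"
      using L unfolding limitin_def by blast
    then show "\<forall>\<^sub>F m in F. \<forall>t\<in>{a..b}. dist (f m t x) (T t x) < e"
      by eventually_elim (simp add: dist_norm)
  qed
  with TX ev show ?R by blast
next
  assume R: ?R
  have "eventually (\<lambda>m. f m \<in> U) F"
    if "generate_topology_on {{S \<in> X. \<forall>t\<in>{a..b}. norm (S t x - T t x) < e} |T x a b e.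
        T \<in> X \<and> {a..b} \<subseteq> J \<and> 0 < e} U" "T \<in> U" for U
    using that
  proof (induction rule: generate_topology_on.induct)
    case Empty
    then show ?case by simp
  next
    case (Int A B)
    then show ?case by (auto intro: eventually_conj)
  next
    case (UN K)
    then obtain k where k: "k \<in> K" "T \<in> k" by blast
    with UN have "eventually (\<lambda>m. f m \<in> k) F" by blast
    then show ?case by eventually_elim (use k in blast)
  next
    case (Basis B)
    then obtain T' x a b e where B: "B = {S \<in> X. \<forall>t\<in>{a..b}. norm (S t x - T' t x) < e}"
      and T': "T' \<in> X" and ab: "{a..b} \<subseteq> J" and e: "0 < e" by blast
    have lt: "norm (T t x - T' t x) < e" if "t \<in> {a..b}" for t
      using Basis.prems that unfolding B by blast
    obtain d where d: "0 < d" "\<And>t. t \<in> {a..b} \<Longrightarrow> norm (T t x - T' t x) \<le> e - d"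
    proof (cases "{a..b} = {}")
      case True
      then show ?thesis using that[of 1] by auto
    next
      case False
      have "continuous_on {a..b} (\<lambda>t. norm (T t x - T' t x))"
        using continuous_on_subset[OF cont ab] R T' by (intro continuous_intros) auto
      from continuous_attains_sup[OF compact_Icc False this]
      obtain s where s: "s \<in> {a..b}"
        "\<And>t. t \<in> {a..b} \<Longrightarrow> norm (T t x - T' t x) \<le> norm (T s x - T' s x)" by blast
      show ?thesis
        using that[of "e - norm (T s x - T' s x)"] lt[OF s(1)] s(2) by auto
    qed
    have "\<forall>\<^sub>F m in F. \<forall>t\<in>{a..b}. dist (f m t x) (T t x) < d"
      using R ab d(1) by (intro uniform_limitD) blast+
    moreover have "\<forall>\<^sub>F m in F. f m \<in> X" using R by blast
    ultimately show ?case
    proof eventually_elim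
      case (elim m)
      have "norm (f m t x - T' t x) < e" if t: "t \<in> {a..b}" for t
      proof -
        have "norm (f m t x - T' t x) \<le> norm (f m t x - T t x) + norm (T t x - T' t x)"
          using norm_triangle_ineq[of "f m t x - T t x" "T t x - T' t x"] by simp
        also have "\<dots> < d + (e - d)"
          using elim t d(2)[OF t] by (intro add_less_le_mono) (auto simp: dist_norm)
        finally show ?thesis by simp
      qed
      with elim show ?case unfolding B by blast
    qed
  qed
  then show ?L
    using R unfolding limitin_def topspace_strong_unif_topology
    by (simp add: strong_unif_topology_def openin_topology_generated_by_iff)
qed


definition nowhere_dense_in :: "'b topology \<Rightarrow> 'b set \<Rightarrow> bool" where
  "nowhere_dense_in X N \<longleftrightarrow> N \<subseteq> topspace X \<and> X interior_of (X closure_of N) = {}"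

definition first_category_in :: "'b topology \<Rightarrow> 'b set \<Rightarrow> bool" where
  "first_category_in X A \<longleftrightarrow>
     (\<exists>\<N>. countable \<N> \<and> (\<forall>N\<in>\<N>. nowhere_dense_in X N) \<and> A = \<Union>\<N>)"

definition residual_in :: "'b topology \<Rightarrow> 'b set \<Rightarrow> bool" where
  "residual_in X R \<longleftrightarrow> R \<subseteq> topspace X \<and> first_category_in X (topspace X - R)"


definition weak_op_tendsto ::
    "('i \<Rightarrow> 'a::complex_inner \<Rightarrow> 'a) \<Rightarrow> ('a \<Rightarrow> 'a) \<Rightarrow> 'i filter \<Rightarrow> bool" where
  "weak_op_tendsto A B F \<longleftrightarrow> (\<forall>x y. ((\<lambda>i. cinner (A i x) y) \<longlongrightarrow> cinner (B x) y) F)"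

definition strong_op_tendsto ::
    "('i \<Rightarrow> 'a::complex_inner \<Rightarrow> 'a) \<Rightarrow> ('a \<Rightarrow> 'a) \<Rightarrow> 'i filter \<Rightarrow> bool" where
  "strong_op_tendsto A B F \<longleftrightarrow> (\<forall>x. ((\<lambda>i. A i x) \<longlongrightarrow> B x) F)"

definition has_density :: "real set \<Rightarrow> real \<Rightarrow> bool" where
  "has_density M d \<longleftrightarrow> M \<subseteq> {0..} \<and> M \<in> sets lebesgue \<and>
     ((\<lambda>t. measure lebesgue (M \<inter> {0..t}) / t) \<longlongrightarrow> d) at_top"

text \<open>The filter \<open>inf at_top (principal M)\<close> is \<open>t \<rightarrow> \<infinity>\<close> with \<open>t \<in> M\<close>.\<close>

definition almost_weakly_stable :: "(real \<Rightarrow> 'a::complex_inner \<Rightarrow> 'a) \<Rightarrow> bool" where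
  "almost_weakly_stable T \<longleftrightarrow>
     (\<exists>M. has_density M 1 \<and> weak_op_tendsto T (\<lambda>x. 0) (inf at_top (principal M)))"

definition unimodular_limits :: "(real \<Rightarrow> 'a::complex_inner \<Rightarrow> 'a) \<Rightarrow> bool" where
  "unimodular_limits T \<longleftrightarrow>
     (\<forall>c. cmod c = 1 \<longrightarrow>
       (\<exists>t :: nat \<Rightarrow> real. (\<forall>j. 0 \<le> t j) \<and> filterlim t at_top sequentially \<and>
          strong_op_tendsto (\<lambda>j. T (t j)) (\<lambda>x. c *\<^sub>C x) sequentially))"

end

theory Submission
  imports "Jordan_Normal_Form.Spectral_Radius" Defs
begin

text \<open>
  Each property follows from countably many open conditions, and each of these conditions holds for
  some arbitrarily small perturbation of any given flow. A locale treats the isometric semigroups and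
  the unitary groups together.

  The open conditions. Let \<open>x\<close> be a dense sequence in \<open>H\<close>. Property (2) follows if for all \<open>n\<close>
  and all rational \<open>q\<close> there is a time \<open>t \<ge> n\<close> at which \<open>T t\<close> moves each of \<open>x 0, \<dots>, x n\<close> to
  within \<open>1 / (n + 1)\<close> of its multiple by \<open>cis q\<close>. For property (1), consider for a vector \<open>y\<close>
  and a window length \<open>N\<close> the supremum of the mean of \<open>|g (T s y)|\<^sup>2\<close> over \<open>{0..N}\<close>, taken over
  all linear functionals \<open>g\<close> of norm at most one. This supremum is continuous in \<open>T\<close>, so that its
  being small for some \<open>N\<close> is an open condition. As \<open>g \<circ> T a\<close> is again a contractive functional, the
  bound holds for all windows of length \<open>N\<close>, and therefore the means over \<open>{0..t}\<close> tend to zero as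
  \<open>t\<close> grows (\<open>functional_mean_tendsto_0\<close>). The Koopman--von Neumann lemma turns this into
  convergence along a set of density one, which can be chosen to serve all pairs of vectors of the
  dense sequence and hence all pairs of vectors (\<open>koopman_von_neumann_sequence\<close>).

  Diagonal groups are dense. Given \<open>T\<close>, finitely many vectors and a time horizon, take a small step
  \<open>h\<close>. On the finitely many vectors \<open>T (j * h) y\<close> the isometry \<open>T h\<close> agrees with a unitary operator
  of a finite-dimensional space, which has an orthonormal eigenbasis. The group that acts on this
  basis with the principal phases per time \<open>h\<close>, and trivially on the orthogonal complement, agrees
  with \<open>T\<close> at the times \<open>j * h\<close>. Because \<open>|cis s - 1|\<close> is monotone for \<open>0 \<le> s \<le> pi\<close>, it moves no
  vector further within a step than at the end of the step, so that it stays close to \<open>T\<close>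
  (\<open>semigroup_approx_diag_group\<close>).

  Perturbing a diagonal group. For the recurrence condition at a late time \<open>t\<close>, changes of the
  frequencies by at most \<open>2 * pi / t\<close> make all phases equal at time \<open>t\<close>
  (\<open>recurrent_perturbation\<close>). For the mixing condition, write each eigenvector as a normalized sum
  of \<open>p\<close> orthonormal vectors, for which there is room in infinite dimension, and give them
  frequencies in a short arithmetic progression. Over the common period the exponentials are
  orthogonal, and a contractive functional sees at most \<open>1 / p\<close> of the orbit on average
  (\<open>mixing_perturbation\<close>).
\<close>

section \<open>Complex inner product spaces\<close>

lemma scaleC_zero_left [simp]: "0 *\<^sub>C x = (0::'a::complex_inner)"
  using scaleC_of_real[of 0 x] by simp

lemma scaleC_one [simp]: "1 *\<^sub>C x = (x::'a::complex_inner)"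
  using scaleC_of_real[of 1 x] by simp

lemma scaleC_zero_right [simp]: "c *\<^sub>C 0 = (0::'a::complex_inner)"
  using scaleC_add_right[of c 0 0] by simp

lemma scaleC_minus1: "(-1) *\<^sub>C x = - (x::'a::complex_inner)"
  using scaleC_of_real[of "-1" x] by simp

lemma scaleC_minus_right: "c *\<^sub>C (- x) = - (c *\<^sub>C (x::'a::complex_inner))"
  by (metis add_eq_0_iff scaleC_add_right scaleC_zero_right)

lemma scaleC_minus_left: "(- c) *\<^sub>C x = - (c *\<^sub>C (x::'a::complex_inner))"
  by (metis add_eq_0_iff add.right_inverse scaleC_add_left scaleC_zero_left)

lemma scaleC_diff_right: "c *\<^sub>C (x - y) = c *\<^sub>C x - c *\<^sub>C (y::'a::complex_inner)"
  using scaleC_add_right[of c x "-y"] by (simp add: scaleC_minus_right)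

lemma scaleC_diff_left: "(c - d) *\<^sub>C x = c *\<^sub>C x - d *\<^sub>C (x::'a::complex_inner)"
  using scaleC_add_left[of c "-d" x] by (simp add: scaleC_minus_left)

lemma scaleC_sum_right: "c *\<^sub>C sum f A = (\<Sum>i\<in>A. c *\<^sub>C (f i::'a::complex_inner))"
  by (induction A rule: infinite_finite_induct) (auto simp: scaleC_add_right)

lemma cinner_zero_left [simp]: "cinner 0 (y::'a::complex_inner) = 0"
  using cinner_add_left[of 0 0 y] by simp

lemma cinner_add_right: "cinner x (y + z) = cinner x y + cinner x (z::'a::complex_inner)"
  by (metis cinner_add_left cinner_commute complex_cnj_add)

lemma cinner_scaleC_right: "cinner x (c *\<^sub>C y) = cnj c * cinner x (y::'a::complex_inner)"
  by (metis cinner_scaleC_left cinner_commute complex_cnj_mult)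

lemma cinner_zero_right [simp]: "cinner (x::'a::complex_inner) 0 = 0"
  using cinner_add_right[of x 0 0] by simp

lemma cinner_minus_left: "cinner (- x) y = - cinner x (y::'a::complex_inner)"
  by (metis add_eq_0_iff cinner_add_left cinner_zero_left)

lemma cinner_minus_right: "cinner x (- y) = - cinner x (y::'a::complex_inner)"
  by (metis add_eq_0_iff cinner_add_right cinner_zero_right)

lemma cinner_diff_left: "cinner (x - y) z = cinner x z - cinner y (z::'a::complex_inner)"
  using cinner_add_left[of x "-y" z] by (simp add: cinner_minus_left)

lemma cinner_diff_right: "cinner z (x - y) = cinner z x - cinner z (y::'a::complex_inner)"
  using cinner_add_right[of z x "-y"] by (simp add: cinner_minus_right)

lemma cinner_sum_left: "cinner (sum f A) y = (\<Sum>i\<in>A. cinner (f i) (y::'a::complex_inner))"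
  by (induction A rule: infinite_finite_induct) (auto simp: cinner_add_left)

lemma cinner_sum_right: "cinner x (sum f A) = (\<Sum>i\<in>A. cinner x (f i::'a::complex_inner))"
  by (induction A rule: infinite_finite_induct) (auto simp: cinner_add_right)

lemma norm_scaleC: "norm (c *\<^sub>C (x::'a::complex_inner)) = cmod c * norm x"
proof -
  have "complex_of_real ((norm (c *\<^sub>C x))\<^sup>2) = (c * cnj c) * complex_of_real ((norm x)\<^sup>2)"
    unfolding cinner_self[symmetric] cinner_scaleC_left cinner_scaleC_right by simp
  also have "\<dots> = complex_of_real ((cmod c)\<^sup>2 * (norm x)\<^sup>2)"
    unfolding complex_norm_square[symmetric] by (simp only: of_real_mult)
  finally have "(norm (c *\<^sub>C x))\<^sup>2 = (cmod c * norm x)\<^sup>2"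
    by (metis of_real_eq_iff power_mult_distrib)
  then show ?thesis by (simp add: power2_eq_iff_nonneg)
qed

lemma bounded_linear_scaleC_left: "bounded_linear (\<lambda>c. c *\<^sub>C (x::'a::complex_inner))"
proof (rule bounded_linear_intro[where K = "norm x"])
  show "(r *\<^sub>R c) *\<^sub>C x = r *\<^sub>R (c *\<^sub>C x)" for r c
    by (simp add: scaleC_of_real[symmetric] scaleC_scaleC scaleR_conv_of_real)
qed (simp_all add: scaleC_add_left norm_scaleC)

lemma cmod_cinner_le: "cmod (cinner x y) \<le> norm x * norm (y::'a::complex_inner)"
proof (cases "cinner x y = 0")
  case False
  define c where "c = cnj (cinner x y) / cmod (cinner x y)"
  have c: "cmod c = 1" using False by (simp add: c_def norm_divide)
  have "cinner (c *\<^sub>C x) y = complex_of_real (cmod (cinner x y))"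
    using False unfolding cinner_scaleC_left c_def
    by (simp add: complex_norm_square[symmetric] field_simps power2_eq_square)
  then have "cmod (cinner x y) = inner (c *\<^sub>C x) y"
    by (simp add: inner_eq_Re_cinner)
  also have "\<dots> \<le> norm (c *\<^sub>C x) * norm y" by (rule norm_cauchy_schwarz)
  finally show ?thesis using c by (simp add: norm_scaleC)
qed simp

lemma bounded_clinearI:
  assumes "\<And>x y. A (x + y) = A x + A y" "\<And>c x. A (c *\<^sub>C x) = c *\<^sub>C A x"
    and "\<And>x. norm (A x) \<le> norm (x::'a::complex_inner)"
  shows "bounded_clinear A"
  unfolding bounded_clinear_def
proof (intro conjI allI)
  show "bounded_linear A"
    by (rule bounded_linear_intro[where K = 1])
      (use assms in \<open>auto simp: scaleC_of_real[symmetric]\<close>)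
qed (use assms in auto)

lemma
  assumes "bounded_clinear A"
  shows bounded_clinear_add: "A (x + y) = A x + A y"
    and bounded_clinear_diff: "A (x - y) = A x - A y"
    and bounded_clinear_scaleC: "A (c *\<^sub>C x) = c *\<^sub>C A x"
    and bounded_clinear_sum: "A (sum f I) = (\<Sum>i\<in>I. A (f i))"
proof -
  have "linear A"
    using assms by (simp add: bounded_clinear_def bounded_linear.linear)
  then show "A (x + y) = A x + A y" "A (x - y) = A x - A y" "A (sum f I) = (\<Sum>i\<in>I. A (f i))"
    by (auto simp: linear_add linear_diff linear_sum)
  show "A (c *\<^sub>C x) = c *\<^sub>C A x"
    using assms by (simp add: bounded_clinear_def)
qed

text \<open>Polarization: an isometry preserves the real inner product, and the imaginary part of
  \<open>cinner x y\<close> is the real part of \<open>cinner x (\<i> *\<^sub>C y)\<close>.\<close>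

lemma isometry_cinner:
  assumes A: "bounded_clinear A" and iso: "\<And>x. norm (A x) = norm x"
  shows "cinner (A x) (A y) = cinner x (y::'a::complex_inner)"
proof -
  have inn: "inner (A x) (A y) = inner x y" for x y
    unfolding dot_norm by (simp add: iso bounded_clinear_add[OF A, symmetric])
  have "Im (cinner x y) = inner x (\<i> *\<^sub>C y)" for x y :: 'a
    by (simp add: inner_eq_Re_cinner cinner_scaleC_right)
  then have "Im (cinner (A x) (A y)) = Im (cinner x y)"
    by (metis inn bounded_clinear_scaleC[OF A])
  with inn[of x y] show ?thesis
    by (simp add: complex_eq_iff inner_eq_Re_cinner)
qed

section \<open>Finite orthonormal families\<close>

definition orthonormal :: "'i set \<Rightarrow> ('i \<Rightarrow> 'a::complex_inner) \<Rightarrow> bool" where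
  "orthonormal I e \<longleftrightarrow> finite I \<and>
     (\<forall>i\<in>I. \<forall>j\<in>I. cinner (e i) (e j) = (if i = j then 1 else 0))"

definition fourier_sum :: "'i set \<Rightarrow> ('i \<Rightarrow> 'a::complex_inner) \<Rightarrow> 'a \<Rightarrow> 'a" where
  "fourier_sum I e x = (\<Sum>i\<in>I. cinner x (e i) *\<^sub>C e i)"

text \<open>The span of an orthonormal family, given by the fixed points of the orthogonal
  projection onto it, so that membership is directly a Fourier expansion.\<close>

definition ospan :: "'i set \<Rightarrow> ('i \<Rightarrow> 'a::complex_inner) \<Rightarrow> 'a set" where
  "ospan I e = {x. fourier_sum I e x = x}"

lemma orthonormalD:
  assumes "orthonormal I e"
  shows "finite I" "\<And>i j. i \<in> I \<Longrightarrow> j \<in> I \<Longrightarrow> cinner (e i) (e j) = (if i = j then 1 else 0)"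
  using assms by (auto simp: orthonormal_def)

lemma cinner_orthonormal_sum:
  assumes "orthonormal I e" "j \<in> I"
  shows "cinner (\<Sum>i\<in>I. c i *\<^sub>C e i) (e j) = c j"
proof -
  have "cinner (\<Sum>i\<in>I. c i *\<^sub>C e i) (e j) = (\<Sum>i\<in>I. if i = j then c i else 0)"
    unfolding cinner_sum_left cinner_scaleC_left
    using orthonormalD[OF assms(1)] assms(2) by (intro sum.cong) auto
  then show ?thesis using orthonormalD(1)[OF assms(1)] assms(2) by simp
qed

lemma orthonormal_sum_in_ospan:
  assumes "orthonormal I e"
  shows "(\<Sum>i\<in>I. c i *\<^sub>C e i) \<in> ospan I e"
  unfolding ospan_def fourier_sum_def using assms by (simp add: cinner_orthonormal_sum)

lemma ospanD: "x \<in> ospan I e \<Longrightarrow> x = (\<Sum>i\<in>I. cinner x (e i) *\<^sub>C e i)"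
  by (simp add: ospan_def fourier_sum_def)

lemma norm_orthonormal_sum:
  assumes "orthonormal I e"
  shows "(norm (\<Sum>i\<in>I. c i *\<^sub>C e i))\<^sup>2 = (\<Sum>i\<in>I. (cmod (c i))\<^sup>2)"
proof -
  have "complex_of_real ((norm (\<Sum>i\<in>I. c i *\<^sub>C e i))\<^sup>2) = (\<Sum>j\<in>I. cnj (c j) * c j)"
    unfolding cinner_self[symmetric] cinner_sum_right[of _ "\<lambda>i. c i *\<^sub>C e i"] cinner_scaleC_right
    using assms by (intro sum.cong) (auto simp: cinner_orthonormal_sum)
  also have "\<dots> = complex_of_real (\<Sum>i\<in>I. (cmod (c i))\<^sup>2)"
    unfolding of_real_sum complex_norm_square by (simp add: mult.commute)
  finally show ?thesis by (simp only: of_real_eq_iff)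
qed

lemma cinner_residual:
  assumes "orthonormal I e" "j \<in> I"
  shows "cinner (x - fourier_sum I e x) (e j) = 0"
  unfolding cinner_diff_left fourier_sum_def cinner_orthonormal_sum[OF assms] by simp

lemma bessel:
  assumes "orthonormal I e"
  shows "(\<Sum>i\<in>I. (cmod (cinner x (e i)))\<^sup>2) \<le> (norm x)\<^sup>2"
proof -
  define p where "p = fourier_sum I e x"
  have "cinner (x - p) p = 0"
    unfolding p_def fourier_sum_def[of I e x] cinner_sum_right cinner_scaleC_right
    using cinner_residual[OF assms] unfolding fourier_sum_def by simp
  then have "inner (x - p) p = 0" by (simp add: inner_eq_Re_cinner)
  then have "(norm x)\<^sup>2 = (norm (x - p))\<^sup>2 + (norm p)\<^sup>2"
    by (simp add: power2_norm_eq_inner inner_diff_left inner_diff_right inner_commute)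
  moreover have "(norm p)\<^sup>2 = (\<Sum>i\<in>I. (cmod (cinner x (e i)))\<^sup>2)"
    unfolding p_def fourier_sum_def by (rule norm_orthonormal_sum[OF assms])
  ultimately show ?thesis by simp
qed

lemma parseval:
  assumes "orthonormal I e" "x \<in> ospan I e"
  shows "(\<Sum>i\<in>I. (cmod (cinner x (e i)))\<^sup>2) = (norm x)\<^sup>2"
  using norm_orthonormal_sum[OF assms(1), of "\<lambda>i. cinner x (e i)"] ospanD[OF assms(2)] by simp

lemma parseval_cinner:
  assumes "x \<in> ospan I e"
  shows "(\<Sum>i\<in>I. cinner x (e i) * cnj (cinner y (e i))) = cinner x y"
proof -
  have "cinner x y = cinner (\<Sum>i\<in>I. cinner x (e i) *\<^sub>C e i) y"
    using ospanD[OF assms] by simp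
  also have "\<dots> = (\<Sum>i\<in>I. cinner x (e i) * cnj (cinner y (e i)))"
    unfolding cinner_sum_left cinner_scaleC_left by (intro sum.cong) (auto intro: cinner_commute)
  finally show ?thesis by simp
qed

lemma orthonormal_in_ospan: "orthonormal I e \<Longrightarrow> i \<in> I \<Longrightarrow> e i \<in> ospan I e"
proof -
  assume e: "orthonormal I e" and i: "i \<in> I"
  have "(\<Sum>j\<in>I. (if j = i then 1 else 0) *\<^sub>C e j) = (\<Sum>j\<in>I. if j = i then e j else 0)"
    by (intro sum.cong) auto
  then show ?thesis
    using orthonormal_sum_in_ospan[OF e, of "\<lambda>j. if j = i then 1 else 0"] i orthonormalD(1)[OF e]
    by simp
qed

lemma norm_orthonormal:
  assumes "orthonormal I e" "i \<in> I"
  shows "norm (e i) = 1"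
proof -
  have "complex_of_real ((norm (e i))\<^sup>2) = 1"
    using orthonormalD(2)[OF assms(1) assms(2) assms(2)] by (simp only: cinner_self) simp
  then have "(norm (e i))\<^sup>2 = 1" by (simp only: of_real_eq_1_iff)
  then show ?thesis by (simp add: power2_eq_1_iff) (metis norm_ge_zero neg_0_le_iff_le not_one_le_zero)
qed

definition csubspace :: "'a::complex_inner set \<Rightarrow> bool" where
  "csubspace G \<longleftrightarrow> 0 \<in> G \<and> (\<forall>x\<in>G. \<forall>y\<in>G. x + y \<in> G) \<and> (\<forall>c. \<forall>x\<in>G. c *\<^sub>C x \<in> G)"

lemma csubspace_sum:
  assumes "csubspace G" "\<And>i. i \<in> A \<Longrightarrow> f i \<in> G" shows "sum f A \<in> G"
  using assms(2)
  by (induction A rule: infinite_finite_induct) (use assms(1) in \<open>auto simp: csubspace_def\<close>)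

lemma
  assumes "csubspace G" "x \<in> G"
  shows csubspace_add: "y \<in> G \<Longrightarrow> x + y \<in> G" and csubspace_scale: "c *\<^sub>C x \<in> G"
  using assms by (auto simp: csubspace_def)

lemma csubspace_diff: "csubspace G \<Longrightarrow> x \<in> G \<Longrightarrow> y \<in> G \<Longrightarrow> x - y \<in> G"
  by (metis add_uminus_conv_diff csubspace_def scaleC_minus1)

lemma csubspace_ospan: "csubspace (ospan I e)"
  unfolding csubspace_def ospan_def fourier_sum_def
  by (auto simp: cinner_add_left cinner_scaleC_left scaleC_add_left sum.distrib
      scaleC_scaleC[symmetric] scaleC_sum_right[symmetric])

lemma ospan_subset:
  assumes "csubspace G" "\<And>i. i \<in> I \<Longrightarrow> e i \<in> G"
  shows "ospan I e \<subseteq> G"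
proof
  fix x assume "x \<in> ospan I e"
  then have "x = (\<Sum>i\<in>I. cinner x (e i) *\<^sub>C e i)" by (rule ospanD)
  moreover have "\<dots> \<in> G"
    using assms by (intro csubspace_sum) (auto simp: csubspace_def)
  ultimately show "x \<in> G" by simp
qed

text \<open>The sum of all \<open>|cinner (e i) (f j)|\<^sup>2\<close> equals \<open>card I\<close> by Parseval's identity and is at most
  \<open>card J\<close> by Bessel's inequality.\<close>

lemma orthonormal_card_le:
  assumes e: "orthonormal I e" and f: "orthonormal J f" and sub: "\<And>i. i \<in> I \<Longrightarrow> e i \<in> ospan J f"
  shows "card I \<le> card J"
proof -
  have "real (card I) = (\<Sum>i\<in>I. (norm (e i))\<^sup>2)"
    using norm_orthonormal[OF e] by simp
  also have "\<dots> = (\<Sum>i\<in>I. \<Sum>j\<in>J. (cmod (cinner (e i) (f j)))\<^sup>2)"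
    using parseval[OF f sub] by simp
  also have "\<dots> = (\<Sum>j\<in>J. \<Sum>i\<in>I. (cmod (cinner (f j) (e i)))\<^sup>2)"
    by (subst sum.swap, intro sum.cong refl) (metis cinner_commute complex_mod_cnj)
  also have "\<dots> \<le> (\<Sum>j\<in>J. (norm (f j))\<^sup>2)"
    by (intro sum_mono bessel e)
  also have "\<dots> = card J" using norm_orthonormal[OF f] by simp
  finally show ?thesis by simp
qed

lemma normalize_vector:
  assumes "x \<noteq> (0::'a::complex_inner)"
  shows "norm (complex_of_real (inverse (norm x)) *\<^sub>C x) = 1"
    and "cinner (complex_of_real (inverse (norm x)) *\<^sub>C x) (complex_of_real (inverse (norm x)) *\<^sub>C x) = 1"
proof -
  show "norm (complex_of_real (inverse (norm x)) *\<^sub>C x) = 1"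
    using assms by (simp add: norm_scaleC norm_inverse)
  then show "cinner (complex_of_real (inverse (norm x)) *\<^sub>C x) (complex_of_real (inverse (norm x)) *\<^sub>C x) = 1"
    by (simp only: cinner_self) simp
qed

lemma orthonormal_insert:
  assumes e: "orthonormal I e" and j: "j \<notin> I" and v: "norm v = 1"
    and orth: "\<And>i. i \<in> I \<Longrightarrow> cinner v (e i) = 0"
  shows "orthonormal (insert j I) (e(j := v))"
proof -
  have "cinner (e i) v = 0" if "i \<in> I" for i
    using orth[OF that] cinner_commute[of "e i" v] by simp
  moreover have "cinner v v = 1" using v by (simp add: cinner_self)
  ultimately show ?thesis
    using e j orth unfolding orthonormal_def by auto
qed

text \<open>Gram--Schmidt, with new vectors taken from a prescribed subspace.\<close>

lemma gram_schmidt: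
  fixes e :: "nat \<Rightarrow> 'a::complex_inner"
  assumes "finite F" and "orthonormal {..<n} e" and G: "csubspace G"
    and "\<And>i. i < n \<Longrightarrow> e i \<in> G" and "F \<subseteq> G"
  obtains n' e' where "n \<le> n'" "orthonormal {..<n'} e'" "\<And>i. i < n \<Longrightarrow> e' i = e i"
    "\<And>i. i < n' \<Longrightarrow> e' i \<in> G" "F \<subseteq> ospan {..<n'} e'"
proof -
  have "\<exists>n' e'. n \<le> n' \<and> orthonormal {..<n'} e' \<and> (\<forall>i<n. e' i = e i) \<and> (\<forall>i<n'. e' i \<in> G)
      \<and> F \<subseteq> ospan {..<n'} e'"
    using assms(1,5)
  proof (induction F rule: finite_induct)
    case empty
    then show ?case using assms by blast
  next
    case (insert x F)
    then obtain m f where m: "n \<le> m" and f: "orthonormal {..<m} f" and fe: "\<forall>i<n. f i = e i"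
      and fG: "\<forall>i<m. f i \<in> G" and F: "F \<subseteq> ospan {..<m} f" by blast
    define r where "r = x - fourier_sum {..<m} f x"
    show ?case
    proof (cases "r = 0")
      case True
      then have "x \<in> ospan {..<m} f" by (simp add: r_def ospan_def)
      then show ?thesis using m f fe fG F by blast
    next
      case False
      define v where "v = complex_of_real (inverse (norm r)) *\<^sub>C r"
      define f' where "f' = f(m := v)"
      have v: "norm v = 1" using normalize_vector[OF False] by (simp add: v_def)
      have "cinner r (f i) = 0" if "i < m" for i
        using cinner_residual[OF f] that by (auto simp: r_def)
      then have "orthonormal (insert m {..<m}) f'"
        unfolding f'_def using v by (intro orthonormal_insert f) (auto simp: v_def cinner_scaleC_left)
      then have f': "orthonormal {..<Suc m} f'" by (simp add: lessThan_Suc)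
      have "r \<in> G"
        unfolding r_def fourier_sum_def using insert.prems fG
        by (intro csubspace_diff csubspace_sum csubspace_scale G) auto
      then have f'G: "\<forall>i<Suc m. f' i \<in> G"
        using fG csubspace_scale[OF G \<open>r \<in> G\<close>] by (simp add: f'_def v_def less_Suc_eq)
      note mem = orthonormal_in_ospan[OF f']
      have "f i \<in> ospan {..<Suc m} f'" if "i < m" for i
        using mem[of i] that by (simp add: f'_def)
      then have sub: "ospan {..<m} f \<subseteq> ospan {..<Suc m} f'"
        by (intro ospan_subset csubspace_ospan) auto
      have "complex_of_real (norm r) *\<^sub>C f' m = r"
        using False by (simp add: f'_def v_def scaleC_scaleC)
      moreover have "complex_of_real (norm r) *\<^sub>C f' m \<in> ospan {..<Suc m} f'"
        by (rule csubspace_scale[OF csubspace_ospan mem]) simp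
      ultimately have "r \<in> ospan {..<Suc m} f'" by (simp only:)
      moreover have "fourier_sum {..<m} f x \<in> ospan {..<Suc m} f'"
        unfolding fourier_sum_def by (rule subsetD[OF sub orthonormal_sum_in_ospan[OF f]])
      ultimately have "r + fourier_sum {..<m} f x \<in> ospan {..<Suc m} f'"
        by (rule csubspace_add[OF csubspace_ospan])
      then have "x \<in> ospan {..<Suc m} f'" by (simp add: r_def)
      then have "insert x F \<subseteq> ospan {..<Suc m} f'" using F sub by blast
      moreover have "\<forall>i<n. f' i = e i" using fe m by (simp add: f'_def)
      ultimately show ?thesis
        using m f' f'G by (intro exI[of _ "Suc m"] exI[of _ f']) simp
    qed
  qed
  then obtain n' e' where *: "n \<le> n'" "orthonormal {..<n'} e'" "\<forall>i<n. e' i = e i"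
    "\<forall>i<n'. e' i \<in> G" "F \<subseteq> ospan {..<n'} e'"
    by (elim exE conjE)
  show ?thesis by (rule that[OF *(1,2) _ _ *(5)]) (simp_all add: *(3,4))
qed

lemma orthonormal_basis_exists:
  fixes F :: "'a::complex_inner set"
  assumes "finite F"
  obtains n and e :: "nat \<Rightarrow> 'a" where "orthonormal {..<n} e" "F \<subseteq> ospan {..<n} e"
proof (rule gram_schmidt[OF assms, of 0 undefined UNIV])
  show "orthonormal {..<0} (undefined :: nat \<Rightarrow> 'a)" by (simp add: orthonormal_def)
qed (auto simp: csubspace_def)

lemma orthonormal_extend_infinite_dim:
  fixes e :: "'i \<Rightarrow> 'a::complex_inner" and J :: "'j set"
  assumes inf: "\<not> finite_dim TYPE('a::complex_inner)" and e: "orthonormal I e" and "finite J"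
  obtains f :: "'j \<Rightarrow> 'a" where "orthonormal J f" "\<And>i j. i \<in> I \<Longrightarrow> j \<in> J \<Longrightarrow> cinner (f j) (e i) = 0"
proof -
  have "\<exists>f. orthonormal J f \<and> (\<forall>i\<in>I. \<forall>j\<in>J. cinner (f j) (e i) = 0)"
    using assms(3)
  proof (induction J rule: finite_induct)
    case empty
    then show ?case by (auto simp: orthonormal_def)
  next
    case (insert k J)
    then obtain f where f: "orthonormal J f" and ef: "\<forall>i\<in>I. \<forall>j\<in>J. cinner (f j) (e i) = 0" by blast
    interpret V: vector_space "scaleC :: complex \<Rightarrow> 'a \<Rightarrow> 'a" by (rule vector_space_scaleC)
    let ?B = "e ` I \<union> f ` J"
    have fin: "finite I" "finite J" using orthonormalD(1) e f by auto
    then have "finite ?B" by simp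
    with inf have "V.span ?B \<noteq> UNIV"
      unfolding finite_dim_def not_ex de_Morgan_conj by (elim allE[of _ ?B]) simp
    then obtain x where x: "x \<notin> V.span ?B" by auto
    define p where "p = fourier_sum I e x + fourier_sum J f x"
    define r where "r = x - p"
    have "p \<in> V.span ?B"
      unfolding p_def fourier_sum_def
      by (intro V.span_add V.span_sum V.span_scale V.span_base) auto
    then have "r \<noteq> 0" using x by (auto simp: r_def)
    have fe: "cinner (e i) (f j) = 0" if "i \<in> I" "j \<in> J" for i j
      using ef that cinner_commute[of "e i" "f j"] by simp
    have "cinner (fourier_sum J f x) (e i) = 0" if "i \<in> I" for i
      using ef that by (simp add: fourier_sum_def cinner_sum_left cinner_scaleC_left)
    then have re: "cinner r (e i) = 0" if "i \<in> I" for i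
      using cinner_residual[OF e that, of x] that by (simp add: r_def p_def cinner_diff_left cinner_add_left)
    have "cinner (fourier_sum I e x) (f j) = 0" if "j \<in> J" for j
      using fe that by (simp add: fourier_sum_def cinner_sum_left cinner_scaleC_left)
    then have rf: "cinner r (f j) = 0" if "j \<in> J" for j
      using cinner_residual[OF f that, of x] that by (simp add: r_def p_def cinner_diff_left cinner_add_left)
    define v where "v = complex_of_real (inverse (norm r)) *\<^sub>C r"
    have "orthonormal (insert k J) (f(k := v))"
      using insert.hyps(2) rf normalize_vector[OF \<open>r \<noteq> 0\<close>]
      by (intro orthonormal_insert f) (auto simp: v_def cinner_scaleC_left)
    moreover have "\<forall>i\<in>I. \<forall>j\<in>insert k J. cinner ((f(k := v)) j) (e i) = 0"
      using ef re insert.hyps(2) by (auto simp: v_def cinner_scaleC_left)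
    ultimately show ?case by blast
  qed
  then obtain f :: "'j \<Rightarrow> 'a" where *: "orthonormal J f" "\<forall>i\<in>I. \<forall>j\<in>J. cinner (f j) (e i) = 0"
    by (elim exE conjE)
  show ?thesis by (rule that[OF *(1)]) (simp add: *(2))
qed

section \<open>Diagonal unitary groups\<close>

text \<open>The unitary group that multiplies \<open>e i\<close> by \<open>cis (\<theta> i * t)\<close> and fixes the orthogonal
  complement of the family.\<close>

definition diag_group ::
    "'i set \<Rightarrow> ('i \<Rightarrow> 'a::complex_inner) \<Rightarrow> ('i \<Rightarrow> real) \<Rightarrow> real \<Rightarrow> 'a \<Rightarrow> 'a" where
  "diag_group I e \<theta> t x = x + (\<Sum>i\<in>I. ((cis (\<theta> i * t) - 1) * cinner x (e i)) *\<^sub>C e i)"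

lemma diag_group_0: "diag_group I e \<theta> 0 x = x"
  by (simp add: diag_group_def)

lemma cinner_diag_group:
  assumes "orthonormal I e" "j \<in> I"
  shows "cinner (diag_group I e \<theta> t x) (e j) = cis (\<theta> j * t) * cinner x (e j)"
  unfolding diag_group_def cinner_add_left cinner_orthonormal_sum[OF assms]
  by (simp add: algebra_simps)

lemma diag_group_ospan:
  assumes "x \<in> ospan I e"
  shows "diag_group I e \<theta> t x = (\<Sum>i\<in>I. (cis (\<theta> i * t) * cinner x (e i)) *\<^sub>C e i)"
proof -
  have "diag_group I e \<theta> t x = (\<Sum>i\<in>I. cinner x (e i) *\<^sub>C e i)
      + (\<Sum>i\<in>I. ((cis (\<theta> i * t) - 1) * cinner x (e i)) *\<^sub>C e i)"
    unfolding diag_group_def using ospanD[OF assms] by simp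
  also have "\<dots> = (\<Sum>i\<in>I. (cis (\<theta> i * t) * cinner x (e i)) *\<^sub>C e i)"
    unfolding sum.distrib[symmetric] scaleC_add_left[symmetric] by (simp add: algebra_simps)
  finally show ?thesis .
qed

lemma diag_group_add_time:
  assumes "orthonormal I e"
  shows "diag_group I e \<theta> (s + t) x = diag_group I e \<theta> s (diag_group I e \<theta> t x)"
proof -
  have "diag_group I e \<theta> s (diag_group I e \<theta> t x) = x + ((\<Sum>i\<in>I. ((cis (\<theta> i * t) - 1) * cinner x (e i)) *\<^sub>C e i)
      + (\<Sum>i\<in>I. ((cis (\<theta> i * s) - 1) * (cis (\<theta> i * t) * cinner x (e i))) *\<^sub>C e i))"
    unfolding diag_group_def[of I e \<theta> s] using cinner_diag_group[OF assms]
    by (simp add: diag_group_def add.assoc)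
  also have "\<dots> = diag_group I e \<theta> (s + t) x"
    unfolding diag_group_def sum.distrib[symmetric] scaleC_add_left[symmetric]
    by (simp add: algebra_simps cis_mult)
  finally show ?thesis by simp
qed

lemma cinner_diag_group_adjoint:
  assumes "orthonormal I e"
  shows "cinner (diag_group I e \<theta> t x) y = cinner x (diag_group I e \<theta> (- t) y)"
proof -
  have "cinner (e i) y = cnj (cinner y (e i))" for i by (rule cinner_commute)
  then show ?thesis
    unfolding diag_group_def cinner_add_left cinner_add_right cinner_sum_left cinner_sum_right
      cinner_scaleC_left cinner_scaleC_right
    by (simp add: cis_cnj algebra_simps)
qed

lemma norm_diag_group:
  assumes "orthonormal I e"
  shows "norm (diag_group I e \<theta> t x) = norm x"
proof -
  have "cinner (diag_group I e \<theta> t x) (diag_group I e \<theta> t x) = cinner x x"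
    unfolding cinner_diag_group_adjoint[OF assms] diag_group_add_time[OF assms, symmetric]
    by (simp add: diag_group_0)
  then have "(norm (diag_group I e \<theta> t x))\<^sup>2 = (norm x)\<^sup>2"
    by (simp only: cinner_self of_real_eq_iff)
  then show ?thesis by (simp add: power2_eq_iff_nonneg)
qed

lemma diag_group_clinear:
  assumes "orthonormal I e"
  shows "bounded_clinear (diag_group I e \<theta> t)"
proof (rule bounded_clinearI)
  show "diag_group I e \<theta> t (x + y) = diag_group I e \<theta> t x + diag_group I e \<theta> t y" for x y
    by (simp add: diag_group_def cinner_add_left distrib_left scaleC_add_left sum.distrib)
  show "diag_group I e \<theta> t (c *\<^sub>C x) = c *\<^sub>C diag_group I e \<theta> t x" for c x
    by (simp add: diag_group_def cinner_scaleC_left scaleC_add_right scaleC_sum_right scaleC_scaleC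
        mult_ac)
qed (simp add: norm_diag_group[OF assms])

lemma diag_group_eigenvector:
  assumes e: "orthonormal I e" and "j \<in> I"
  shows "diag_group I e \<theta> t (e j) = cis (\<theta> j * t) *\<^sub>C e j"
proof -
  have "diag_group I e \<theta> t (e j) = (\<Sum>i\<in>I. (cis (\<theta> i * t) * cinner (e j) (e i)) *\<^sub>C e i)"
    by (rule diag_group_ospan[OF orthonormal_in_ospan[OF assms]])
  also have "\<dots> = (\<Sum>i\<in>I. if i = j then cis (\<theta> j * t) *\<^sub>C e j else 0)"
    using orthonormalD(2)[OF e \<open>j \<in> I\<close>] by (intro sum.cong) auto
  finally show ?thesis using orthonormalD(1)[OF e] \<open>j \<in> I\<close> by simp
qed

lemma diag_group_ospan_sum:
  assumes "orthonormal J f" "x \<in> ospan I e"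
  shows "diag_group J f \<theta> t x = (\<Sum>i\<in>I. cinner x (e i) *\<^sub>C diag_group J f \<theta> t (e i))"
proof -
  note D = diag_group_clinear[OF assms(1)]
  have "diag_group J f \<theta> t x = diag_group J f \<theta> t (\<Sum>i\<in>I. cinner x (e i) *\<^sub>C e i)"
    using ospanD[OF assms(2)] by simp
  then show ?thesis by (simp add: bounded_clinear_sum[OF D] bounded_clinear_scaleC[OF D])
qed

lemma diag_group_unitary_group:
  assumes e: "orthonormal I e"
  shows "diag_group I e \<theta> \<in> unitary_groups"
proof -
  have "continuous_on UNIV (\<lambda>t. diag_group I e \<theta> t x)" for x
    unfolding diag_group_def
    by (intro continuous_intros bounded_linear.continuous_on[OF bounded_linear_scaleC_left])
  moreover have "unitary (diag_group I e \<theta> t)" for t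
    unfolding unitary_def adjoint_of_def
    by (intro conjI exI[of _ "diag_group I e \<theta> (- t)"])
      (auto simp: diag_group_clinear[OF e] cinner_diag_group_adjoint[OF e] fun_eq_iff
        diag_group_add_time[OF e, symmetric] diag_group_0)
  ultimately show ?thesis
    unfolding unitary_groups_def C0_group_def
    by (auto simp: diag_group_clinear[OF e] fun_eq_iff diag_group_add_time[OF e] diag_group_0)
qed

lemma norm_diag_group_diff:
  assumes "orthonormal I e"
  shows "(norm (diag_group I e \<theta> s x - diag_group I e \<phi> t x))\<^sup>2
    = (\<Sum>i\<in>I. (cmod (cis (\<theta> i * s) - cis (\<phi> i * t)))\<^sup>2 * (cmod (cinner x (e i)))\<^sup>2)"
proof -
  have "diag_group I e \<theta> s x - diag_group I e \<phi> t x
      = (\<Sum>i\<in>I. ((cis (\<theta> i * s) - cis (\<phi> i * t)) * cinner x (e i)) *\<^sub>C e i)"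
    unfolding diag_group_def add_diff_add diff_self add_0 sum_subtractf[symmetric]
      scaleC_diff_left[symmetric] by (simp add: algebra_simps)
  then show ?thesis
    by (simp only: norm_orthonormal_sum[OF assms] norm_mult power_mult_distrib)
qed

lemma cmod_cis_diff: "cmod (cis a - cis b) = 2 * \<bar>sin ((a - b) / 2)\<bar>"
proof -
  have "cis a - cis b = cis b * (cis (a - b) - 1)"
    by (simp add: right_diff_distrib cis_mult)
  also have "cis (a - b) = exp (\<i> * complex_of_real (a - b))" by (rule cis_conv_exp)
  finally show ?thesis
    by (simp only: norm_mult norm_cis dist_exp_i_1)
qed

text \<open>Small changes of the frequencies are small perturbations on bounded time intervals.\<close>

lemma diag_group_perturb:
  assumes e: "orthonormal I e" and \<eta>: "\<And>i. i \<in> I \<Longrightarrow> \<bar>\<theta> i - \<phi> i\<bar> \<le> \<eta>" and "0 \<le> \<eta>"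
  shows "norm (diag_group I e \<theta> t x - diag_group I e \<phi> t x) \<le> \<eta> * \<bar>t\<bar> * norm x"
proof -
  have "cmod (cis (\<theta> i * t) - cis (\<phi> i * t)) \<le> \<eta> * \<bar>t\<bar>" if "i \<in> I" for i
  proof -
    have "cmod (cis (\<theta> i * t) - cis (\<phi> i * t)) \<le> 2 * \<bar>(\<theta> i * t - \<phi> i * t) / 2\<bar>"
      unfolding cmod_cis_diff by (intro mult_left_mono abs_sin_x_le_abs_x) auto
    also have "\<dots> = \<bar>\<theta> i - \<phi> i\<bar> * \<bar>t\<bar>" by (simp add: abs_mult[symmetric] left_diff_distrib)
    finally show ?thesis using mult_right_mono[OF \<eta>[OF that], of "\<bar>t\<bar>"] by simp
  qed
  then have "(norm (diag_group I e \<theta> t x - diag_group I e \<phi> t x))\<^sup>2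
      \<le> (\<Sum>i\<in>I. (\<eta> * \<bar>t\<bar>)\<^sup>2 * (cmod (cinner x (e i)))\<^sup>2)"
    unfolding norm_diag_group_diff[OF e] by (intro sum_mono mult_right_mono power_mono) auto
  also have "\<dots> \<le> (\<eta> * \<bar>t\<bar>)\<^sup>2 * (norm x)\<^sup>2"
    unfolding sum_distrib_left[symmetric] by (intro mult_left_mono bessel[OF e]) auto
  finally show ?thesis
    unfolding power_mult_distrib[symmetric] using \<open>0 \<le> \<eta>\<close> by (auto intro: power2_le_imp_le)
qed

text \<open>If the phases \<open>\<theta> i * h\<close> are principal, then the group moves a vector before time \<open>h\<close> no
  further than at time \<open>h\<close>, since \<open>|cis s - 1| = 2 |sin (s / 2)|\<close> increases with \<open>|s| \<le> \<pi>\<close>.\<close>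

lemma diag_group_displacement_mono:
  assumes e: "orthonormal I e" and \<theta>: "\<And>i. i \<in> I \<Longrightarrow> \<bar>\<theta> i * h\<bar> \<le> pi" and s: "0 \<le> s" "s \<le> h"
  shows "norm (diag_group I e \<theta> s x - x) \<le> norm (diag_group I e \<theta> h x - x)"
proof -
  have le: "cmod (cis (\<theta> i * s) - cis (\<theta> i * 0)) \<le> cmod (cis (\<theta> i * h) - cis (\<theta> i * 0))"
    if "i \<in> I" for i
  proof -
    have abs: "\<bar>sin (y / 2)\<bar> = sin (\<bar>y\<bar> / 2)" if "\<bar>y\<bar> \<le> pi" for y :: real
    proof -
      have "0 \<le> sin (\<bar>y\<bar> / 2)" using that by (intro sin_ge_zero) auto
      moreover have "\<bar>sin (y / 2)\<bar> = \<bar>sin (\<bar>y\<bar> / 2)\<bar>" by (cases "0 \<le> y") auto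
      ultimately show ?thesis by simp
    qed
    have sh: "\<bar>\<theta> i * s\<bar> \<le> \<bar>\<theta> i * h\<bar>"
      using s by (simp add: abs_mult mult_left_mono)
    then have "sin (\<bar>\<theta> i * s\<bar> / 2) \<le> sin (\<bar>\<theta> i * h\<bar> / 2)"
      using \<theta>[OF that] pi_gt_zero by (intro sin_monotone_2pi_le) linarith+
    then show ?thesis
      using abs[OF order_trans[OF sh \<theta>[OF that]]] abs[OF \<theta>[OF that]] unfolding cmod_cis_diff by simp
  qed
  have "(norm (diag_group I e \<theta> s x - diag_group I e \<theta> 0 x))\<^sup>2
      \<le> (norm (diag_group I e \<theta> h x - diag_group I e \<theta> 0 x))\<^sup>2"
    unfolding norm_diag_group_diff[OF e] by (intro sum_mono mult_right_mono power_mono le) auto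
  from power2_le_imp_le[OF this] show ?thesis by (simp add: diag_group_0)
qed

section \<open>Eigenbases of isometries on finite-dimensional subspaces\<close>

text \<open>An eigenvector of the matrix of \<open>W\<close> in the basis \<open>e\<close> supplies the coordinates.\<close>

lemma eigenvector_exists:
  fixes e :: "nat \<Rightarrow> 'a::complex_inner"
  assumes e: "orthonormal {..<n} e" and "0 < n" and W: "bounded_clinear W"
    and inv: "\<And>i. i < n \<Longrightarrow> W (e i) \<in> ospan {..<n} e"
  obtains v \<mu> where "v \<in> ospan {..<n} e" "v \<noteq> 0" "W v = \<mu> *\<^sub>C v"
proof -
  define A where "A = Matrix.mat n n (\<lambda>(i, j). cinner (W (e j)) (e i))"
  have A: "A \<in> carrier_mat n n" by (simp add: A_def)
  from spectrum_non_empty[OF A \<open>0 < n\<close>] obtain \<mu> where "eigenvalue A \<mu>"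
    by (auto simp: spectrum_def)
  then obtain z where z: "z \<in> carrier_vec n" "z \<noteq> 0\<^sub>v n" "A *\<^sub>v z = \<mu> \<cdot>\<^sub>v z"
    using A by (auto simp: eigenvalue_def eigenvector_def)
  define v where "v = (\<Sum>j<n. vec_index z j *\<^sub>C e j)"
  have row: "(\<Sum>j<n. vec_index z j * cinner (W (e j)) (e i)) = \<mu> * vec_index z i" if "i < n" for i
  proof -
    have "(\<Sum>j<n. cinner (W (e j)) (e i) * vec_index z j) = vec_index (A *\<^sub>v z) i"
      using that z(1) by (simp add: A_def scalar_prod_def atLeast0LessThan)
    then show ?thesis using z that by (simp add: mult.commute)
  qed
  have "W v = (\<Sum>j<n. vec_index z j *\<^sub>C W (e j))"
    by (simp add: v_def bounded_clinear_sum[OF W] bounded_clinear_scaleC[OF W])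
  also have "\<dots> = (\<Sum>j<n. vec_index z j *\<^sub>C (\<Sum>i<n. cinner (W (e j)) (e i) *\<^sub>C e i))"
    by (intro sum.cong refl arg_cong[where f = "(*\<^sub>C) _"] ospanD inv) simp
  also have "\<dots> = (\<Sum>i<n. (\<Sum>j<n. vec_index z j * cinner (W (e j)) (e i)) *\<^sub>C e i)"
    unfolding scaleC_sum_right scaleC_scaleC
      linear_sum[OF bounded_linear.linear[OF bounded_linear_scaleC_left]] by (rule sum.swap)
  also have "\<dots> = \<mu> *\<^sub>C v"
    unfolding v_def scaleC_sum_right scaleC_scaleC by (intro sum.cong) (auto simp: row)
  finally have "W v = \<mu> *\<^sub>C v" .
  moreover have "v \<noteq> 0"
  proof
    assume "v = 0"
    then have "vec_index z j = 0" if "j < n" for j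
      using cinner_orthonormal_sum[OF e, of j "vec_index z"] that by (simp add: v_def)
    then show False using z(1,2) by auto
  qed
  moreover have "v \<in> ospan {..<n} e"
    unfolding v_def by (rule orthonormal_sum_in_ospan[OF e])
  ultimately show ?thesis by (intro that)
qed

text \<open>Take a maximal orthonormal family of eigenvectors. Its orthogonal complement in the
  invariant subspace is invariant because the operator is isometric there, hence contains one more
  eigenvector unless it is zero.\<close>

lemma eigenbasis_exists:
  fixes e :: "nat \<Rightarrow> 'a::complex_inner"
  assumes e: "orthonormal {..<n} e" and W: "bounded_clinear W"
    and inv: "\<And>i. i < n \<Longrightarrow> W (e i) \<in> ospan {..<n} e"
    and iso: "\<And>x y. x \<in> ospan {..<n} e \<Longrightarrow> y \<in> ospan {..<n} e \<Longrightarrow> cinner (W x) (W y) = cinner x y"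
  obtains m and u :: "nat \<Rightarrow> 'a" and \<mu> where "orthonormal {..<m} u"
    "ospan {..<n} e \<subseteq> ospan {..<m} u"
    "\<And>i. i < m \<Longrightarrow> cmod (\<mu> i) = 1" "\<And>i. i < m \<Longrightarrow> W (u i) = \<mu> i *\<^sub>C u i"
proof -
  define G where "G = ospan {..<n} e"
  have G: "csubspace G" by (simp add: G_def csubspace_ospan)
  have eG: "e i \<in> G" if "i < n" for i using orthonormal_in_ospan[OF e] that by (simp add: G_def)
  have WG: "W x \<in> G" if "x \<in> G" for x
  proof -
    have x: "x = (\<Sum>i<n. cinner x (e i) *\<^sub>C e i)"
      by (rule ospanD) (use that in \<open>simp add: G_def\<close>)
    have "W x = W (\<Sum>i<n. cinner x (e i) *\<^sub>C e i)" using x by simp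
    also have "\<dots> = (\<Sum>i<n. cinner x (e i) *\<^sub>C W (e i))"
      by (simp add: bounded_clinear_sum[OF W] bounded_clinear_scaleC[OF W])
    also have "\<dots> \<in> G" using inv by (intro csubspace_sum csubspace_scale G) (auto simp: G_def)
    finally show ?thesis .
  qed
  define P where "P k \<longleftrightarrow> (\<exists>u. orthonormal {..<k} u \<and>
      (\<forall>i<k. u i \<in> G \<and> (\<exists>\<mu>. cmod \<mu> = 1 \<and> W (u i) = \<mu> *\<^sub>C u i)))" for k :: nat
  have "P 0" by (auto simp: P_def orthonormal_def)
  moreover have "k \<le> n" if "P k" for k
    using that orthonormal_card_le[of "{..<k}" _ "{..<n}" e] e by (auto simp: P_def G_def)
  ultimately obtain k where "P k" and kmax: "\<And>j. P j \<Longrightarrow> j \<le> k"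
    using GreatestI_nat[of P 0 n] Greatest_le_nat[of P _ n] by blast
  then obtain u where u: "orthonormal {..<k} u" and uG: "\<And>i. i < k \<Longrightarrow> u i \<in> G"
    and "\<forall>i<k. \<exists>\<mu>. cmod \<mu> = 1 \<and> W (u i) = \<mu> *\<^sub>C u i" by (auto simp: P_def)
  then obtain \<mu> where \<mu>: "\<And>i. i < k \<Longrightarrow> cmod (\<mu> i) = 1" "\<And>i. i < k \<Longrightarrow> W (u i) = \<mu> i *\<^sub>C u i"
    by metis
  obtain m u' where km: "k \<le> m" and u': "orthonormal {..<m} u'" and u'u: "\<And>i. i < k \<Longrightarrow> u' i = u i"
    and u'G: "\<And>i. i < m \<Longrightarrow> u' i \<in> G" and eu': "e ` {..<n} \<subseteq> ospan {..<m} u'"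
    by (rule gram_schmidt[OF _ u G, of "e ` {..<n}"]) (use uG eG in auto)
  have Gu': "G \<subseteq> ospan {..<m} u'"
    unfolding G_def using eu' by (intro ospan_subset csubspace_ospan) auto
  have "m = k"
  proof (rule ccontr)
    assume "m \<noteq> k"
    with km have km: "k < m" by simp
    define w where "w j = u' (k + j)" for j
    have w: "orthonormal {..<m - k} w"
      using u' by (auto simp: orthonormal_def w_def)
    have wG: "w j \<in> G" and wu: "\<And>i. i < k \<Longrightarrow> cinner (w j) (u i) = 0" if "j < m - k" for j
      using that u'G orthonormalD(2)[OF u'] u'u by (auto simp: w_def simp flip: u'u)
    have "W (w j) \<in> ospan {..<m - k} w" if j: "j < m - k" for j
    proof -
      have "cinner (W (w j)) (u' i) = 0" if "i < k" for i
      proof -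
        have "cnj (\<mu> i) * cinner (W (w j)) (u i) = cinner (W (w j)) (W (u i))"
          by (simp add: \<mu>(2)[OF that] cinner_scaleC_right)
        also have "\<dots> = 0"
          using iso wG[OF j] uG[OF that] wu[OF j that] by (simp add: G_def)
        finally show ?thesis using \<mu>(1)[OF that] u'u[OF that] by auto
      qed
      then have "(\<Sum>i<k. cinner (W (w j)) (u' i) *\<^sub>C u' i) = 0" by simp
      moreover have "{..<m} = {..<k} \<union> {k..<m}" using km by auto
      moreover have "W (w j) = (\<Sum>i<m. cinner (W (w j)) (u' i) *\<^sub>C u' i)"
        by (rule ospanD, rule subsetD[OF Gu' WG[OF wG[OF j]]])
      ultimately have "W (w j) = (\<Sum>i\<in>{k..<m}. cinner (W (w j)) (u' i) *\<^sub>C u' i)"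
        by (simp add: sum.union_disjoint ivl_disj_int)
      also have "\<dots> = (\<Sum>i<m - k. cinner (W (w j)) (w i) *\<^sub>C w i)"
        by (rule sum.reindex_bij_witness[of _ "\<lambda>i. k + i" "\<lambda>i. i - k"]) (auto simp: w_def)
      finally show ?thesis unfolding ospan_def fourier_sum_def by simp
    qed
    then obtain v \<nu> where v: "v \<in> ospan {..<m - k} w" "v \<noteq> 0" "W v = \<nu> *\<^sub>C v"
      using eigenvector_exists[OF w _ W] km zero_less_diff by metis
    have "ospan {..<m - k} w \<subseteq> G" using wG by (intro ospan_subset G) auto
    then have vG: "v \<in> G" using v by blast
    have vu: "cinner v (u i) = 0" if "i < k" for i
    proof -
      have "cinner (\<Sum>j<m - k. cinner v (w j) *\<^sub>C w j) (u i) = 0"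
        unfolding cinner_sum_left cinner_scaleC_left using wu[OF _ that] by simp
      then show ?thesis using ospanD[OF v(1)] by simp
    qed
    have "cinner (W v) (W v) = cinner v v" using iso vG by (simp add: G_def)
    then have "(norm (W v))\<^sup>2 = (norm v)\<^sup>2" by (simp only: cinner_self of_real_eq_iff)
    then have "norm (W v) = norm v" by (simp add: power2_eq_iff_nonneg)
    then have \<nu>: "cmod \<nu> = 1" using v by (simp add: norm_scaleC)
    define v' where "v' = complex_of_real (inverse (norm v)) *\<^sub>C v"
    have "norm v' = 1" using normalize_vector(1)[OF v(2)] by (simp add: v'_def)
    then have "orthonormal (insert k {..<k}) (u(k := v'))"
      by (intro orthonormal_insert u) (auto simp: v'_def cinner_scaleC_left vu)
    moreover have "v' \<in> G" using csubspace_scale[OF G vG] by (simp add: v'_def)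
    moreover have "W v' = \<nu> *\<^sub>C v'"
      by (simp add: v'_def bounded_clinear_scaleC[OF W] v(3) scaleC_scaleC mult.commute)
    ultimately have "P (Suc k)"
      unfolding P_def lessThan_Suc using uG \<mu> \<nu>
      by (intro exI[of _ "u(k := v')"]) (auto simp: less_Suc_eq)
    then show False using kmax by fastforce
  qed
  moreover have "ospan {..<m} u' = ospan {..<m} u"
    using u'u \<open>m = k\<close> by (simp add: ospan_def fourier_sum_def)
  ultimately show ?thesis
    using that[of k u \<mu>] u \<mu> Gu' by (simp add: G_def)
qed

text \<open>An isometry need not map any nonzero finite-dimensional subspace into itself, but its restriction to
  one extends to a unitary operator of a larger finite-dimensional subspace: complete orthonormal
  bases of the domain and of the range to two orthonormal bases of their common span.\<close>

lemma isometry_agrees_with_diagonal: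
  fixes V :: "'a::complex_inner \<Rightarrow> 'a"
  assumes V: "bounded_clinear V" and iso: "\<And>x. norm (V x) = norm x" and "finite F"
  obtains m and u :: "nat \<Rightarrow> 'a" and \<mu> where "orthonormal {..<m} u" "F \<subseteq> ospan {..<m} u"
    "\<And>i. i < m \<Longrightarrow> cmod (\<mu> i) = 1"
    "\<And>x. x \<in> F \<Longrightarrow> V x = (\<Sum>i<m. (\<mu> i * cinner x (u i)) *\<^sub>C u i)"
proof -
  obtain r and e :: "nat \<Rightarrow> 'a" where e: "orthonormal {..<r} e" and F: "F \<subseteq> ospan {..<r} e"
    using orthonormal_basis_exists[OF \<open>finite F\<close>] by blast
  obtain n e' where rn: "r \<le> n" and e': "orthonormal {..<n} e'" and e'e: "\<And>i. i < r \<Longrightarrow> e' i = e i"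
    and Ve: "(V \<circ> e) ` {..<r} \<subseteq> ospan {..<n} e'"
    by (rule gram_schmidt[OF _ e, of "(V \<circ> e) ` {..<r}" UNIV]) (auto simp: csubspace_def)
  let ?G = "ospan {..<n} e'"
  have d: "orthonormal {..<r} (V \<circ> e)"
    using e by (simp add: orthonormal_def isometry_cinner[OF V iso])
  have e'G: "e' i \<in> ?G" if "i < n" for i using orthonormal_in_ospan[OF e'] that by simp
  obtain n' d' where d': "orthonormal {..<n'} d'" and d'd: "\<And>i. i < r \<Longrightarrow> d' i = (V \<circ> e) i"
    and rn': "r \<le> n'"
    and d'G: "\<And>i. i < n' \<Longrightarrow> d' i \<in> ?G" and e'd': "e' ` {..<n} \<subseteq> ospan {..<n'} d'"
    by (rule gram_schmidt[OF _ d csubspace_ospan, of "e' ` {..<n}" "{..<n}" e']) (use Ve e'G in auto)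
  \<comment> \<open>Both families span \<open>?G\<close>, so that matching them is an isometry of \<open>?G\<close> onto itself.\<close>
  have "n' = n"
    using orthonormal_card_le[OF d' e'] orthonormal_card_le[OF e' d'] d'G e'd' by fastforce
  define W where "W x = (\<Sum>i<n. cinner x (e' i) *\<^sub>C d' i)" for x
  have dn: "orthonormal {..<n} d'" using d' \<open>n' = n\<close> by simp
  have W: "bounded_clinear W"
  proof (rule bounded_clinearI)
    show "norm (W x) \<le> norm x" for x
    proof (rule power2_le_imp_le)
      show "(norm (W x))\<^sup>2 \<le> (norm x)\<^sup>2"
        unfolding W_def norm_orthonormal_sum[OF dn] by (rule bessel[OF e'])
    qed simp
  qed (simp_all add: W_def cinner_add_left cinner_scaleC_left scaleC_add_left sum.distrib
      scaleC_sum_right scaleC_scaleC)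
  have Wd: "cinner (W x) (d' i) = cinner x (e' i)" if "i < n" for x i
    unfolding W_def using cinner_orthonormal_sum[OF dn] that by simp
  have We: "W (e i) = V (e i)" if "i < r" for i
  proof -
    have "W (e' i) = (\<Sum>j<n. (if j = i then 1 else 0) *\<^sub>C d' j)"
      unfolding W_def using orthonormalD(2)[OF e', of i] rn that by (intro sum.cong) auto
    also have "\<dots> = (\<Sum>j<n. if j = i then d' j else 0)" by (intro sum.cong) auto
    also have "\<dots> = V (e i)" using that rn d'd by simp
    finally show ?thesis using e'e[OF that] by simp
  qed
  have WV: "W x = V x" if "x \<in> F" for x
  proof -
    have x: "x = (\<Sum>i<r. cinner x (e i) *\<^sub>C e i)" using F that by (intro ospanD) auto
    have "W (\<Sum>i<r. cinner x (e i) *\<^sub>C e i) = V (\<Sum>i<r. cinner x (e i) *\<^sub>C e i)"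
      by (simp add: bounded_clinear_sum[OF W] bounded_clinear_scaleC[OF W]
          bounded_clinear_sum[OF V] bounded_clinear_scaleC[OF V] We)
    then show ?thesis using x by simp
  qed
  have WG: "W x \<in> ?G" for x
    unfolding W_def using d'G \<open>n' = n\<close> by (intro csubspace_sum csubspace_scale csubspace_ospan) auto
  have Wiso: "cinner (W x) (W y) = cinner x y" if "x \<in> ?G" "y \<in> ?G" for x y
  proof -
    have "cinner (W x) (W y) = (\<Sum>i<n. cinner (W x) (d' i) * cnj (cinner (W y) (d' i)))"
      by (rule parseval_cinner[symmetric]) (simp add: W_def orthonormal_sum_in_ospan[OF dn])
    also have "\<dots> = (\<Sum>i<n. cinner x (e' i) * cnj (cinner y (e' i)))" by (simp add: Wd)
    also have "\<dots> = cinner x y" by (rule parseval_cinner[OF that(1)])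
    finally show ?thesis .
  qed
  obtain m and u :: "nat \<Rightarrow> 'a" and \<mu> where u: "orthonormal {..<m} u"
    and Gu: "?G \<subseteq> ospan {..<m} u"
    and \<mu>: "\<And>i. i < m \<Longrightarrow> cmod (\<mu> i) = 1" "\<And>i. i < m \<Longrightarrow> W (u i) = \<mu> i *\<^sub>C u i"
    using eigenbasis_exists[OF e' W WG Wiso] by blast
  have "ospan {..<r} e \<subseteq> ?G"
    using e'G e'e rn by (intro ospan_subset csubspace_ospan) (metis lessThan_iff order_less_le_trans)
  then have Fu: "F \<subseteq> ospan {..<m} u" using F Gu by blast
  have "V x = (\<Sum>i<m. (\<mu> i * cinner x (u i)) *\<^sub>C u i)" if "x \<in> F" for x
  proof -
    have x: "x = (\<Sum>i<m. cinner x (u i) *\<^sub>C u i)" using Fu that by (intro ospanD) auto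
    have "V x = W (\<Sum>i<m. cinner x (u i) *\<^sub>C u i)" using WV[OF that] x by simp
    also have "\<dots> = (\<Sum>i<m. cinner x (u i) *\<^sub>C W (u i))"
      by (simp add: bounded_clinear_sum[OF W] bounded_clinear_scaleC[OF W])
    also have "\<dots> = (\<Sum>i<m. (\<mu> i * cinner x (u i)) *\<^sub>C u i)"
      using \<mu>(2) by (intro sum.cong) (auto simp: scaleC_scaleC mult.commute)
    finally show ?thesis .
  qed
  then show ?thesis using that[OF u Fu \<mu>(1)] by simp
qed

section \<open>Approximation by diagonal groups\<close>

lemma
  assumes "T \<in> isometric_semigroups"
  shows isometric_semigroup_clinear: "0 \<le> t \<Longrightarrow> bounded_clinear (T t)"
    and isometric_semigroup_norm: "0 \<le> t \<Longrightarrow> norm (T t x) = norm x"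
    and isometric_semigroup_0: "T 0 x = x"
    and isometric_semigroup_add: "0 \<le> s \<Longrightarrow> 0 \<le> t \<Longrightarrow> T (s + t) x = T s (T t x)"
    and isometric_semigroup_continuous: "continuous_on {0..} (\<lambda>t. T t x)"
  using assms by (auto simp: isometric_semigroups_def C0_semigroup_def isometric_def)

lemma unitary_norm:
  assumes "unitary U"
  shows "norm (U x) = norm x"
proof -
  obtain V where V: "adjoint_of U V" "V \<circ> U = id" using assms by (auto simp: unitary_def)
  have "cinner (U x) (U x) = cinner x (V (U x))" using V by (simp add: adjoint_of_def)
  also have "V (U x) = x" using V(2) by (metis comp_apply id_apply)
  finally have "(norm (U x))\<^sup>2 = (norm x)\<^sup>2" by (simp only: cinner_self of_real_eq_iff)
  then show ?thesis by (simp add: power2_eq_iff_nonneg)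
qed

lemma
  assumes "T \<in> unitary_groups"
  shows unitary_group_clinear: "bounded_clinear (T t)"
    and unitary_group_norm: "norm (T t x) = norm x"
    and unitary_group_0: "T 0 x = x"
    and unitary_group_add: "T (s + t) x = T s (T t x)"
    and unitary_group_continuous: "continuous_on A (\<lambda>t. T t x)"
  using assms
  by (auto simp: unitary_groups_def C0_group_def unitary_norm intro: continuous_on_subset)

lemma restrict_unitary_group:
  assumes "T \<in> unitary_groups"
  shows "restrict T {0..} \<in> isometric_semigroups"
proof -
  have "continuous_on {0..} (\<lambda>t. restrict T {0..} t x)" for x
    using unitary_group_continuous[OF assms] by (rule continuous_on_eq) simp
  then show ?thesis
    unfolding isometric_semigroups_def C0_semigroup_def isometric_def
    by (auto simp: fun_eq_iff unitary_group_clinear[OF assms] unitary_group_norm[OF assms]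
        unitary_group_0[OF assms] unitary_group_add[OF assms])
qed

lemma cis_Arg_unit: "cmod z = 1 \<Longrightarrow> cis (Arg z) = z"
  using cis_Arg[of z] by (cases "z = 0") (auto simp: sgn_div_norm)

lemma common_time_step:
  assumes T: "T \<in> isometric_semigroups" and "finite F" and "0 < \<epsilon>"
  obtains h where "0 < h" "\<And>x s. x \<in> F \<Longrightarrow> 0 \<le> s \<Longrightarrow> s \<le> h \<Longrightarrow> norm (T s x - x) < \<epsilon>"
proof -
  have "\<exists>h>0. \<forall>s. 0 \<le> s \<and> s \<le> h \<longrightarrow> norm (T s x - x) < \<epsilon>" for x
  proof -
    obtain d where d: "0 < d" "\<And>s. s \<in> {0..} \<Longrightarrow> dist s 0 < d \<Longrightarrow> dist (T s x) (T 0 x) < \<epsilon>"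
      using isometric_semigroup_continuous[OF T, of x] \<open>0 < \<epsilon>\<close>
      unfolding continuous_on_iff by (metis atLeast_iff order_refl)
    show ?thesis
      using d by (intro exI[of _ "d / 2"]) (auto simp: dist_norm isometric_semigroup_0[OF T])
  qed
  then obtain h where h: "\<And>x. 0 < h x" "\<And>x s. 0 \<le> s \<Longrightarrow> s \<le> h x \<Longrightarrow> norm (T s x - x) < \<epsilon>"
    by metis
  show ?thesis
  proof (rule that)
    show "0 < Min (insert 1 (h ` F))" using \<open>finite F\<close> h(1) by simp
    show "norm (T s x - x) < \<epsilon>" if "x \<in> F" "0 \<le> s" "s \<le> Min (insert 1 (h ` F))" for x s
      using that \<open>finite F\<close> by (intro h(2)) auto
  qed
qed

text \<open>Sample the semigroup with a small step \<open>h\<close>. On the finitely many vectors that occur up to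
  time \<open>b\<close>, the isometry \<open>T h\<close> agrees with a diagonal operator; the diagonal group with the
  principal phases interpolates the samples, and between two samples neither evolution moves far.\<close>

lemma semigroup_approx_diag_group:
  fixes T :: "real \<Rightarrow> 'a::complex_inner \<Rightarrow> 'a"
  assumes T: "T \<in> isometric_semigroups" and "finite F" and "0 < \<epsilon>"
  obtains m and u :: "nat \<Rightarrow> 'a" and \<theta> where "orthonormal {..<m} u" "F \<subseteq> ospan {..<m} u"
    "\<And>x t. x \<in> F \<Longrightarrow> 0 \<le> t \<Longrightarrow> t \<le> b \<Longrightarrow> norm (diag_group {..<m} u \<theta> t x - T t x) < \<epsilon>"
proof -
  obtain h where h: "0 < h"
    "\<And>x s. x \<in> F \<Longrightarrow> 0 \<le> s \<Longrightarrow> s \<le> h \<Longrightarrow> norm (T s x - x) < \<epsilon> / 2"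
    using common_time_step[OF T \<open>finite F\<close>, of "\<epsilon> / 2"] \<open>0 < \<epsilon>\<close> by auto
  define M where "M = nat \<lceil>b / h\<rceil>"
  define F' where "F' = (\<lambda>(j, x). T (real j * h) x) ` ({..M} \<times> F)"
  have "finite F'" using \<open>finite F\<close> by (simp add: F'_def)
  have Th: "bounded_clinear (T h)" "\<And>x. norm (T h x) = norm x"
    using isometric_semigroup_clinear[OF T] isometric_semigroup_norm[OF T] h by auto
  obtain m and u :: "nat \<Rightarrow> 'a" and \<mu> where u: "orthonormal {..<m} u" and F': "F' \<subseteq> ospan {..<m} u"
    and \<mu>: "\<And>i. i < m \<Longrightarrow> cmod (\<mu> i) = 1"
    and V: "\<And>x. x \<in> F' \<Longrightarrow> T h x = (\<Sum>i<m. (\<mu> i * cinner x (u i)) *\<^sub>C u i)"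
    using isometry_agrees_with_diagonal[OF Th \<open>finite F'\<close>] by metis
  define \<theta> where "\<theta> i = Arg (\<mu> i) / h" for i
  let ?D = "diag_group {..<m} u \<theta>"
  have \<theta>: "\<bar>\<theta> i * h\<bar> \<le> pi" for i
    using Arg_bounded[of "\<mu> i"] h by (auto simp: \<theta>_def)
  have \<theta>\<mu>: "cis (\<theta> i * h) = \<mu> i" if "i < m" for i
    using cis_Arg_unit[OF \<mu>[OF that]] h by (simp add: \<theta>_def)
  have Dh: "?D h y = T h y" if "y \<in> F'" for y
    using diag_group_ospan[of y "{..<m}" u \<theta> h] F' that by (auto simp: V \<theta>\<mu> intro!: sum.cong)
  have mem: "T (real j * h) x \<in> F'" if "x \<in> F" "j \<le> M" for x j
    using that by (auto simp: F'_def)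
  have sample: "?D (real j * h) x = T (real j * h) x" if "x \<in> F" "j \<le> M" for x j
    using that(2)
  proof (induction j)
    case (Suc j)
    have "?D (real (Suc j) * h) x = ?D h (?D (real j * h) x)"
      by (simp add: distrib_right diag_group_add_time[OF u])
    also have "\<dots> = T h (T (real j * h) x)" using Suc Dh mem[OF that(1)] by simp
    also have "\<dots> = T (real (Suc j) * h) x"
      using h isometric_semigroup_add[OF T, of h "real j * h" x] by (simp add: distrib_right)
    finally show ?case .
  qed (simp add: diag_group_0 isometric_semigroup_0[OF T])
  show ?thesis
  proof (rule that[OF u])
    show "F \<subseteq> ospan {..<m} u"
      using mem[of _ 0] F' by (auto simp: isometric_semigroup_0[OF T])
    fix x t assume x: "x \<in> F" and t: "0 \<le> t" "t \<le> b"
    define j where "j = nat \<lfloor>t / h\<rfloor>"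
    define s where "s = t - real j * h"
    have th: "0 \<le> t / h" using t h by simp
    then have "real j = real_of_int \<lfloor>t / h\<rfloor>" by (simp add: j_def)
    then have "real j \<le> t / h" "t / h < real j + 1" by linarith+
    then have s: "0 \<le> s" "s \<le> h" using h by (auto simp: s_def field_simps)
    have "t / h \<le> b / h" using t h by (simp add: divide_right_mono)
    then have "j \<le> M" unfolding j_def M_def
      by (intro nat_mono) (meson floor_le_ceiling floor_mono order_trans)
    have tj: "t = real j * h + s" by (simp add: s_def)
    have "?D t x - T t x = ?D (real j * h) (?D s x - x) + T (real j * h) (x - T s x)"
      unfolding tj diag_group_add_time[OF u]
      using isometric_semigroup_add[OF T, of "real j * h" s x] s h sample[OF x \<open>j \<le> M\<close>]
        bounded_clinear_diff[OF diag_group_clinear[OF u]]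
        bounded_clinear_diff[OF isometric_semigroup_clinear[OF T, of "real j * h"]] by simp
    then have "norm (?D t x - T t x) \<le> norm (?D s x - x) + norm (x - T s x)"
      using norm_triangle_ineq[of "?D (real j * h) (?D s x - x)" "T (real j * h) (x - T s x)"] h
      by (simp add: norm_diag_group[OF u] isometric_semigroup_norm[OF T])
    also have "norm (?D s x - x) \<le> norm (?D h x - x)"
      by (rule diag_group_displacement_mono[OF u \<theta> s])
    also have "?D h x = T h x" using Dh mem[OF x, of 0] by (simp add: isometric_semigroup_0[OF T])
    also have "norm (T h x - x) + norm (x - T s x) < \<epsilon> / 2 + \<epsilon> / 2"
      using h x s by (intro add_strict_mono) (auto simp: norm_minus_commute)
    finally show "norm (?D t x - T t x) < \<epsilon>" by simp
  qed
qed

text \<open>For a group, start the approximation at time \<open>- b\<close>, from the vectors \<open>T (- b) x\<close>.\<close>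

lemma group_approx_diag_group:
  fixes T :: "real \<Rightarrow> 'a::complex_inner \<Rightarrow> 'a"
  assumes T: "T \<in> unitary_groups" and "finite F" and "0 < \<epsilon>" and "0 \<le> b"
  obtains m and u :: "nat \<Rightarrow> 'a" and \<theta> where "orthonormal {..<m} u" "F \<subseteq> ospan {..<m} u"
    "\<And>x t. x \<in> F \<Longrightarrow> \<bar>t\<bar> \<le> b \<Longrightarrow> norm (diag_group {..<m} u \<theta> t x - T t x) < \<epsilon>"
proof -
  have "finite (F \<union> T (- b) ` F)" "0 < \<epsilon> / 2" using assms by auto
  from semigroup_approx_diag_group[OF restrict_unitary_group[OF T] this, of "2 * b"]
  obtain m and u :: "nat \<Rightarrow> 'a" and \<theta> where u: "orthonormal {..<m} u"
    and F: "F \<union> T (- b) ` F \<subseteq> ospan {..<m} u"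
    and D: "\<And>x t. x \<in> F \<union> T (- b) ` F \<Longrightarrow> 0 \<le> t \<Longrightarrow> t \<le> 2 * b
      \<Longrightarrow> norm (diag_group {..<m} u \<theta> t x - restrict T {0..} t x) < \<epsilon> / 2" by metis
  let ?D = "diag_group {..<m} u \<theta>"
  show ?thesis
  proof (rule that[OF u])
    show "F \<subseteq> ospan {..<m} u" using F by blast
    fix x t assume x: "x \<in> F" and t: "\<bar>t\<bar> \<le> b"
    let ?y = "T (- b) x"
    have shift: "T (s + b) ?y = T s x" for s
      by (simp add: unitary_group_add[OF T, symmetric])
    have "norm (?D (t + b) ?y - T t x) < \<epsilon> / 2"
      using D[of ?y "t + b"] x t shift by auto
    moreover have "norm (?D t x - ?D (t + b) ?y) < \<epsilon> / 2"
    proof -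
      have "?D t x - ?D (t + b) ?y = ?D t (x - ?D b ?y)"
        by (simp add: diag_group_add_time[OF u] bounded_clinear_diff[OF diag_group_clinear[OF u]])
      then show ?thesis
        using D[of ?y b] x \<open>0 \<le> b\<close> shift[of 0]
        by (simp add: norm_diag_group[OF u] unitary_group_0[OF T] norm_minus_commute)
    qed
    ultimately show "norm (?D t x - T t x) < \<epsilon>"
      using norm_triangle_ineq[of "?D t x - ?D (t + b) ?y" "?D (t + b) ?y - T t x"] by simp
  qed
qed

section \<open>Contractive functionals\<close>

text \<open>Testing against all contractive functionals, rather than against one vector, is what makes
  the bounds on time averages below invariant under shifts: composition with an isometry preserves
  this set.\<close>

definition functional_ball :: "('a::complex_inner \<Rightarrow> complex) set" where
  "functional_ball = {g. (\<forall>x y. g (x + y) = g x + g y) \<and> (\<forall>c x. g (c *\<^sub>C x) = c * g x) \<and>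
     (\<forall>x. cmod (g x) \<le> norm x)}"

lemma
  assumes "g \<in> functional_ball"
  shows functional_ball_add: "g (x + y) = g x + g y"
    and functional_ball_scaleC: "g (c *\<^sub>C x) = c * g x"
    and functional_ball_norm: "cmod (g x) \<le> norm x"
  using assms by (auto simp: functional_ball_def)

lemma functional_ball_linear:
  assumes "g \<in> functional_ball"
  shows "bounded_linear g"
proof (rule bounded_linear_intro[where K = 1])
  show "g (r *\<^sub>R x) = r *\<^sub>R g x" for r x
    using functional_ball_scaleC[OF assms, of "complex_of_real r" x]
    by (simp add: scaleC_of_real scaleR_conv_of_real)
qed (use functional_ball_add[OF assms] functional_ball_norm[OF assms] in auto)

lemma functional_ball_sum: "g \<in> functional_ball \<Longrightarrow> g (sum f A) = (\<Sum>i\<in>A. g (f i))"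
  by (simp add: linear_sum[OF bounded_linear.linear[OF functional_ball_linear]])

lemma functional_ball_diff: "g \<in> functional_ball \<Longrightarrow> g (x - y) = g x - g y"
  by (simp add: linear_diff[OF bounded_linear.linear[OF functional_ball_linear]])

lemma functional_ball_continuous:
  assumes "g \<in> functional_ball" "continuous_on S f"
  shows "continuous_on S (\<lambda>s. (cmod (g (f s)))\<^sup>2)"
  by (intro continuous_intros bounded_linear.continuous_on[OF functional_ball_linear] assms)

lemma functional_ball_compose:
  assumes "g \<in> functional_ball" "bounded_clinear A" "\<And>x. norm (A x) = norm x"
  shows "(\<lambda>x. g (A x)) \<in> functional_ball"
proof -
  have "cmod (g (A x)) \<le> norm x" for x
    using functional_ball_norm[OF assms(1), of "A x"] assms(3) by simp
  then show ?thesis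
    unfolding functional_ball_def
    by (simp add: bounded_clinear_add[OF assms(2)] bounded_clinear_scaleC[OF assms(2)]
        functional_ball_add[OF assms(1)] functional_ball_scaleC[OF assms(1)])
qed

lemma functional_ball_cinner:
  assumes "norm y \<le> 1"
  shows "(\<lambda>x. cinner x y) \<in> functional_ball"
proof -
  have "cmod (cinner x y) \<le> norm x" for x
    using cmod_cinner_le[of x y] mult_left_mono[OF assms, of "norm x"] by simp
  then show ?thesis by (simp add: functional_ball_def cinner_add_left cinner_scaleC_left)
qed

text \<open>Bessel's inequality for functionals: test on \<open>\<Sum>i\<in>I. cnj (g (f i)) *\<^sub>C f i\<close>.\<close>

lemma functional_ball_bessel:
  assumes g: "g \<in> functional_ball" and f: "orthonormal I f"
  shows "(\<Sum>i\<in>I. (cmod (g (f i)))\<^sup>2) \<le> 1"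
proof -
  define S where "S = (\<Sum>i\<in>I. (cmod (g (f i)))\<^sup>2)"
  define z where "z = (\<Sum>i\<in>I. cnj (g (f i)) *\<^sub>C f i)"
  have S0: "0 \<le> S" by (simp add: S_def sum_nonneg)
  have "g z = (\<Sum>i\<in>I. cnj (g (f i)) * g (f i))"
    by (simp add: z_def functional_ball_sum[OF g] functional_ball_scaleC[OF g])
  also have "\<dots> = complex_of_real S"
    unfolding S_def of_real_sum complex_norm_square by (simp add: mult.commute)
  finally have "S \<le> norm z"
    using functional_ball_norm[OF g, of z] S0 by simp
  moreover have "(norm z)\<^sup>2 = S"
    unfolding z_def norm_orthonormal_sum[OF f] by (simp add: S_def)
  ultimately have "S\<^sup>2 \<le> S" using S0 power_mono[of S "norm z" 2] by simp
  then have "S \<le> 1"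
    using S0 by (cases "S = 0") (auto simp: power2_eq_square mult_le_cancel_left1)
  then show ?thesis by (simp add: S_def)
qed

section \<open>Perturbing the frequencies of a diagonal group\<close>

lemma finite_norm_bound:
  assumes "finite F"
  obtains B where "0 < B" "\<And>x. x \<in> F \<Longrightarrow> norm x \<le> B"
proof -
  have "norm x \<le> (\<Sum>y\<in>F. norm y) + 1" if "x \<in> F" for x
    using member_le_sum[of x F norm] that assms by force
  moreover have "0 < (\<Sum>y\<in>F. norm y) + 1" by (simp add: add_nonneg_pos sum_nonneg)
  ultimately show ?thesis using that by blast
qed

text \<open>At a late time \<open>t\<close> the frequencies need to move by at most \<open>2 * pi / t\<close> for all phases to
  coincide with the prescribed one.\<close>

lemma recurrent_perturbation:
  fixes e :: "'i \<Rightarrow> 'a::complex_inner"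
  assumes e: "orthonormal I e" and "finite F" and F: "F \<subseteq> ospan I e"
    and "0 < \<epsilon>" and "0 \<le> b" and c: "cmod c = 1"
  obtains \<phi> t where "n \<le> t" "0 \<le> t" "\<And>x. x \<in> F \<Longrightarrow> diag_group I e \<phi> t x = c *\<^sub>C x"
    "\<And>x s. x \<in> F \<Longrightarrow> \<bar>s\<bar> \<le> b \<Longrightarrow> norm (diag_group I e \<phi> s x - diag_group I e \<theta> s x) < \<epsilon>"
proof -
  obtain B where B: "0 < B" "\<And>x. x \<in> F \<Longrightarrow> norm x \<le> B" using finite_norm_bound[OF \<open>finite F\<close>] by blast
  \<comment> \<open>Late enough for frequency changes of \<open>2 * pi / t\<close> to be harmless up to time \<open>b\<close>.\<close>
  define t where "t = max n (2 * pi * (b * B) / \<epsilon> + 1)"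
  have pos: "0 \<le> 2 * pi * (b * B) / \<epsilon>" using \<open>0 < \<epsilon>\<close> \<open>0 \<le> b\<close> B by simp
  have t: "0 < t" "n \<le> t" "2 * pi * (b * B) / \<epsilon> < t" using pos by (auto simp: t_def)
  \<comment> \<open>The last frequency up to \<open>\<theta> i\<close> whose phase at time \<open>t\<close> is that of \<open>c\<close>.\<close>
  define \<phi> where
    "\<phi> i = (Arg c + 2 * pi * of_int \<lfloor>(\<theta> i * t - Arg c) / (2 * pi)\<rfloor>) / t" for i
  define \<eta> where "\<eta> = 2 * pi / t"
  have close: "\<bar>\<phi> i - \<theta> i\<bar> \<le> \<eta>" for i
  proof -
    define r where "r = (\<theta> i * t - Arg c) / (2 * pi)"
    have "\<phi> i - \<theta> i = 2 * pi * (of_int \<lfloor>r\<rfloor> - r) / t"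
      using t by (simp add: \<phi>_def r_def field_simps)
    moreover have "\<bar>of_int \<lfloor>r\<rfloor> - r\<bar> \<le> 1" by linarith
    ultimately show ?thesis
      using t by (simp add: \<eta>_def abs_mult divide_right_mono)
  qed
  have small: "\<eta> * b * B < \<epsilon>"
    using t \<open>0 < \<epsilon>\<close> by (simp add: \<eta>_def field_simps)
  have phase: "cis (\<phi> i * t) = c" for i
  proof -
    have "\<phi> i * t = Arg c + 2 * pi * of_int \<lfloor>(\<theta> i * t - Arg c) / (2 * pi)\<rfloor>"
      using t by (simp add: \<phi>_def)
    then have "cis (\<phi> i * t) = cis (Arg c) * cis (2 * pi * of_int \<lfloor>(\<theta> i * t - Arg c) / (2 * pi)\<rfloor>)"
      by (simp only: cis_mult)
    also have "\<dots> = cis (Arg c)" by (subst cis_multiple_2pi) simp_all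
    also have "\<dots> = c" by (rule cis_Arg_unit[OF c])
    finally show ?thesis .
  qed
  show ?thesis
  proof (rule that)
    show "n \<le> t" "0 \<le> t" using t by auto
    show "diag_group I e \<phi> t x = c *\<^sub>C x" if "x \<in> F" for x
    proof -
      have x: "x \<in> ospan I e" using F that by blast
      have "diag_group I e \<phi> t x = c *\<^sub>C (\<Sum>i\<in>I. cinner x (e i) *\<^sub>C e i)"
        unfolding diag_group_ospan[OF x] phase scaleC_sum_right scaleC_scaleC ..
      then show ?thesis using ospanD[OF x] by simp
    qed
    show "norm (diag_group I e \<phi> s x - diag_group I e \<theta> s x) < \<epsilon>" if "x \<in> F" "\<bar>s\<bar> \<le> b" for x s
    proof -
      have \<eta>: "0 \<le> \<eta>" using t by (simp add: \<eta>_def)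
      have "norm (diag_group I e \<phi> s x - diag_group I e \<theta> s x) \<le> \<eta> * \<bar>s\<bar> * norm x"
        by (rule diag_group_perturb[OF e close \<eta>])
      also have "\<dots> \<le> \<eta> * b * B"
        using that B \<eta> \<open>0 \<le> b\<close> by (intro mult_mono) auto
      finally show ?thesis using small by simp
    qed
  qed
qed

lemma cis_int_mult_has_integral:
  assumes "0 < \<delta>"
  shows "((\<lambda>s. cis (of_int k * \<delta> * s)) has_integral (if k = 0 then 2 * pi / \<delta> else 0)) {0..2 * pi / \<delta>}"
proof (cases "k = 0")
  case True
  then show ?thesis
    using has_integral_const_real[of "1 :: complex" 0 "2 * pi / \<delta>"] assms
    by (simp add: scaleR_conv_of_real)
next
  case False
  define a where "a = \<i> * complex_of_real (of_int k * \<delta>)"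
  have a: "a \<noteq> 0" using False assms by (simp add: a_def)
  have cis: "cis (of_int k * \<delta> * s) = exp (a * complex_of_real s)" for s
    by (simp add: cis_conv_exp a_def mult.assoc)
  have "((\<lambda>s. exp (a * complex_of_real s)) has_integral
      exp (a * complex_of_real (2 * pi / \<delta>)) / a - exp (a * complex_of_real 0) / a) {0..2 * pi / \<delta>}"
  proof (rule fundamental_theorem_of_calculus)
    show "((\<lambda>s. exp (a * complex_of_real s) / a) has_vector_derivative exp (a * complex_of_real x))
        (at x within {0..2 * pi / \<delta>})" for x
      using a by (auto intro!: derivative_eq_intros has_vector_derivative_real_field simp: field_simps)
  qed (use assms in simp)
  moreover have "exp (a * complex_of_real (2 * pi / \<delta>)) = cis (2 * pi * of_int k)"
    unfolding cis[symmetric] using assms by (simp add: mult_ac)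
  moreover have "cis (2 * pi * of_int k) = 1" by (rule cis_multiple_2pi) simp
  ultimately show ?thesis using False by (simp add: cis)
qed

text \<open>The exponentials are orthogonal over the period of their frequency differences.\<close>

lemma trig_polynomial_has_integral:
  fixes z :: "nat \<Rightarrow> complex"
  assumes "0 < \<delta>"
  shows "((\<lambda>s. (cmod (\<Sum>l<p. z l * cis ((\<alpha> + real l * \<delta>) * s)))\<^sup>2) has_integral
    (2 * pi / \<delta>) * (\<Sum>l<p. (cmod (z l))\<^sup>2)) {0..2 * pi / \<delta>}"
proof -
  let ?N = "2 * pi / \<delta>"
  have cis: "cis ((\<alpha> + real l * \<delta>) * s) * cnj (cis ((\<alpha> + real m * \<delta>) * s))
      = cis (of_int (int l - int m) * \<delta> * s)" for l m s
    by (simp add: cis_cnj cis_mult algebra_simps)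
  have expand: "complex_of_real ((cmod (\<Sum>l<p. z l * cis ((\<alpha> + real l * \<delta>) * s)))\<^sup>2)
      = (\<Sum>l<p. \<Sum>m<p. z l * cnj (z m) * cis (of_int (int l - int m) * \<delta> * s))" for s
    unfolding complex_norm_square cnj_sum sum_product cis[symmetric] complex_cnj_mult
    by (simp add: mult_ac)
  have "((\<lambda>s. \<Sum>l<p. \<Sum>m<p. z l * cnj (z m) * cis (of_int (int l - int m) * \<delta> * s)) has_integral
      (\<Sum>l<p. \<Sum>m<p. z l * cnj (z m) * (if int l - int m = 0 then ?N else 0))) {0..?N}"
    by (intro has_integral_sum has_integral_mult_right cis_int_mult_has_integral assms) auto
  moreover have "(\<Sum>l<p. \<Sum>m<p. z l * cnj (z m) * (if int l - int m = 0 then ?N else 0))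
      = complex_of_real (?N * (\<Sum>l<p. (cmod (z l))\<^sup>2))"
  proof -
    have "(\<Sum>m<p. z l * cnj (z m) * (if int l - int m = 0 then ?N else 0))
        = (\<Sum>m<p. if m = l then z l * cnj (z l) * ?N else 0)" if "l < p" for l
      by (intro sum.cong) auto
    then have "(\<Sum>l<p. \<Sum>m<p. z l * cnj (z m) * (if int l - int m = 0 then ?N else 0))
        = (\<Sum>l<p. complex_of_real ((cmod (z l))\<^sup>2) * ?N)"
      unfolding complex_norm_square by (intro sum.cong) auto
    then show ?thesis by (simp add: sum_distrib_left mult_ac)
  qed
  ultimately have "((\<lambda>s. complex_of_real ((cmod (\<Sum>l<p. z l * cis ((\<alpha> + real l * \<delta>) * s)))\<^sup>2))
      has_integral complex_of_real (?N * (\<Sum>l<p. (cmod (z l))\<^sup>2))) {0..?N}"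
    by (simp only: expand)
  from has_integral_linear[OF this bounded_linear_Re] show ?thesis by (simp add: o_def)
qed

text \<open>Each unit vector \<open>e k\<close> of an orthonormal family is the normalized sum of \<open>p\<close> orthonormal
  vectors \<open>f (k, l)\<close>. Such vectors arise from an orthonormal family \<open>h\<close> orthogonal to \<open>e\<close> by the
  reflection that exchanges \<open>e k\<close> with the normalized sum \<open>w k\<close> of the \<open>h (k, l)\<close>.\<close>

lemma split_orthonormal:
  fixes e :: "nat \<Rightarrow> 'a::complex_inner"
  assumes inf: "\<not> finite_dim TYPE('a::complex_inner)" and e: "orthonormal {..<m} e" and "0 < p"
  obtains f where "orthonormal ({..<m} \<times> {..<p}) f"
    "\<And>k. k < m \<Longrightarrow> e k = (\<Sum>l<p. complex_of_real (1 / sqrt (real p)) *\<^sub>C f (k, l))"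
proof -
  define a where "a = complex_of_real (1 / sqrt (real p))"
  have aa: "a * a * of_nat p = 1"
  proof -
    have "a * a * of_nat p = complex_of_real ((1 / sqrt p) * (1 / sqrt p) * real p)"
      by (simp only: a_def of_real_mult of_real_of_nat_eq)
    also have "(1 / sqrt p) * (1 / sqrt p) * real p = 1" using \<open>0 < p\<close> by simp
    finally show ?thesis by simp
  qed
  have ca: "cnj a = a" by (simp add: a_def)
  let ?J = "{..<m} \<times> {..<p}"
  obtain h where h: "orthonormal ?J h"
    and he: "\<And>i j. i \<in> {..<m} \<Longrightarrow> j \<in> ?J \<Longrightarrow> cinner (h j) (e i) = 0"
    by (rule orthonormal_extend_infinite_dim[OF inf e, of ?J]) auto
  have eh: "cinner (e i) (h j) = 0" if "i < m" "j \<in> ?J" for i j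
    using he[of i j] that cinner_commute[of "e i" "h j"] by simp
  define w where "w k = (\<Sum>l<p. a *\<^sub>C h (k, l))" for k
  have hw: "cinner (h (k, l)) (w k') = (if k = k' then a else 0)" if "k < m" "k' < m" "l < p" for k k' l
  proof -
    have "cinner (h (k, l)) (w k') = (\<Sum>l'<p. if l' = l then (if k = k' then a else 0) else 0)"
      unfolding w_def cinner_sum_right cinner_scaleC_right
      using orthonormalD(2)[OF h] that by (intro sum.cong) (auto simp: ca)
    then show ?thesis using that by simp
  qed
  have wh: "cinner (w k') (h (k, l)) = (if k = k' then a else 0)" if "k < m" "k' < m" "l < p" for k k' l
    using hw[OF that] cinner_commute[of "w k'" "h (k, l)"] ca by auto
  have ww: "cinner (w k) (w k') = (if k = k' then 1 else 0)" if "k < m" "k' < m" for k k'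
  proof -
    have "cinner (w k) (w k') = (\<Sum>l<p. a * (if k = k' then a else 0))"
      unfolding w_def[of k] cinner_sum_left cinner_scaleC_left using hw that by (intro sum.cong) auto
    then show ?thesis using aa by (simp add: mult_ac)
  qed
  have ew: "cinner (e k) (w k') = 0" if "k < m" "k' < m" for k k'
    unfolding w_def cinner_sum_right cinner_scaleC_right using eh that by simp
  have we: "cinner (w k) (e k') = 0" if "k < m" "k' < m" for k k'
    unfolding w_def cinner_sum_left cinner_scaleC_left using he that by simp
  define f where "f j = h j + a *\<^sub>C (e (fst j) - w (fst j))" for j
  have "cinner (f (k, l)) (f (k', l')) = (if (k, l) = (k', l') then 1 else 0)"
    if "k < m" "k' < m" "l < p" "l' < p" for k k' l l'
  proof -
    have "cinner (f (k, l)) (f (k', l')) = cinner (h (k, l)) (h (k', l'))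
        + a * (cinner (h (k, l)) (e k') - cinner (h (k, l)) (w k'))
        + (a * (cinner (e k) (h (k', l')) - cinner (w k) (h (k', l')))
        + a * a * (cinner (e k) (e k') - cinner (e k) (w k') - (cinner (w k) (e k') - cinner (w k) (w k'))))"
      by (simp add: f_def cinner_add_left cinner_add_right cinner_scaleC_left cinner_scaleC_right
          cinner_diff_left cinner_diff_right ca algebra_simps)
    also have "\<dots> = (if (k, l) = (k', l') then 1 else 0)"
      using that orthonormalD(2)[OF h, of "(k, l)" "(k', l')"] orthonormalD(2)[OF e, of k k']
      by (auto simp: he eh hw wh ew we ww)
    finally show ?thesis .
  qed
  then have "orthonormal ?J f" unfolding orthonormal_def by auto
  moreover have "e k = (\<Sum>l<p. a *\<^sub>C f (k, l))" for k
  proof -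
    have "(\<Sum>l<p. a *\<^sub>C f (k, l)) = w k + (\<Sum>l<p. (a * a) *\<^sub>C (e k - w k))"
      unfolding f_def w_def scaleC_add_right sum.distrib by (simp add: scaleC_scaleC)
    also have "(\<Sum>l<p. (a * a) *\<^sub>C (e k - w k)) = (a * a * of_nat p) *\<^sub>C (e k - w k)"
      unfolding linear_sum[OF bounded_linear.linear[OF bounded_linear_scaleC_left], symmetric]
      by (simp add: mult_ac)
    finally show ?thesis by (simp add: aa)
  qed
  ultimately show ?thesis using that[of f] by (simp add: a_def)
qed

text \<open>Spread each eigenvector over \<open>p\<close> new ones whose frequencies form a short arithmetic
  progression of step \<open>\<delta>\<close>. Over the period \<open>2 * pi / \<delta>\<close> the \<open>p\<close> exponentials are orthogonal,
  so that no functional sees more than \<open>1 / p\<close> of the orbit of an eigenvector on average.\<close>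

lemma mixing_perturbation:
  fixes e :: "nat \<Rightarrow> 'a::complex_inner"
  assumes inf: "\<not> finite_dim TYPE('a::complex_inner)" and e: "orthonormal {..<m} e"
    and "finite F" and F: "F \<subseteq> ospan {..<m} e" and "0 < \<epsilon>" and "0 \<le> b" and "0 < c"
  obtains J and f :: "nat \<times> nat \<Rightarrow> 'a" and \<phi> N where "orthonormal J f" "0 < N"
    "\<And>x s. x \<in> F \<Longrightarrow> \<bar>s\<bar> \<le> b \<Longrightarrow> norm (diag_group J f \<phi> s x - diag_group {..<m} e \<theta> s x) < \<epsilon>"
    "\<And>x g. x \<in> F \<Longrightarrow> g \<in> functional_ball
      \<Longrightarrow> integral {0..N} (\<lambda>s. (cmod (g (diag_group J f \<phi> s x)))\<^sup>2) \<le> c * N"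
proof -
  obtain B where B: "0 < B" "\<And>x. x \<in> F \<Longrightarrow> norm x \<le> B" using finite_norm_bound[OF \<open>finite F\<close>] by blast
  \<comment> \<open>Each of the \<open>m\<close> eigenvectors contributes at most \<open>1 / p\<close>, weighted by \<open>B\<^sup>2\<close>.\<close>
  define p where "p = nat \<lceil>B\<^sup>2 * real m / c\<rceil> + 1"
  have p0: "0 < p" by (simp add: p_def)
  have "B\<^sup>2 * real m / c \<le> real p" unfolding p_def by linarith
  then have "B\<^sup>2 * real m / real p \<le> c"
    using \<open>0 < c\<close> p0 by (simp add: divide_le_eq mult.commute)
  note p = p0 this
  define a where "a = complex_of_real (1 / sqrt (real p))"
  let ?J = "{..<m} \<times> {..<p}"
  obtain f where f: "orthonormal ?J f" and ef: "\<And>k. k < m \<Longrightarrow> e k = (\<Sum>l<p. a *\<^sub>C f (k, l))"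
    using split_orthonormal[OF inf e p(1)] unfolding a_def by blast
  \<comment> \<open>The frequencies change by less than \<open>p * \<delta>\<close>, which is harmless up to time \<open>b\<close>.\<close>
  define \<delta> where "\<delta> = \<epsilon> / (real p * (b + 1) * B)"
  have \<delta>: "0 < \<delta>" using \<open>0 < \<epsilon>\<close> \<open>0 \<le> b\<close> p B by (simp add: \<delta>_def)
  define \<phi> where "\<phi> j = \<theta> (fst j) + real (snd j) * \<delta>" for j
  define N where "N = 2 * pi / \<delta>"
  have N: "0 < N" using \<delta> by (simp add: N_def)
  let ?D = "diag_group ?J f"
  have De: "?D \<psi> s (e k) = (\<Sum>l<p. (a * cis (\<psi> (k, l) * s)) *\<^sub>C f (k, l))" if "k < m" for \<psi> s k
  proof -
    note D = diag_group_clinear[OF f]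
    have "?D \<psi> s (e k) = (\<Sum>l<p. a *\<^sub>C ?D \<psi> s (f (k, l)))"
      using ef[OF that] by (simp add: bounded_clinear_sum[OF D] bounded_clinear_scaleC[OF D])
    also have "\<dots> = (\<Sum>l<p. (a * cis (\<psi> (k, l) * s)) *\<^sub>C f (k, l))"
      using that by (intro sum.cong) (auto simp: diag_group_eigenvector[OF f] scaleC_scaleC)
    finally show ?thesis .
  qed
  have unsplit: "?D (\<lambda>j. \<theta> (fst j)) s x = diag_group {..<m} e \<theta> s x" if "x \<in> F" for x s
  proof -
    have x: "x \<in> ospan {..<m} e" using that F by blast
    have "?D (\<lambda>j. \<theta> (fst j)) s (e k) = cis (\<theta> k * s) *\<^sub>C e k" if "k < m" for k
    proof -
      have "?D (\<lambda>j. \<theta> (fst j)) s (e k) = cis (\<theta> k * s) *\<^sub>C (\<Sum>l<p. a *\<^sub>C f (k, l))"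
        by (simp add: De[OF that] scaleC_sum_right scaleC_scaleC mult.commute)
      then show ?thesis using ef[OF that] by simp
    qed
    then show ?thesis
      unfolding diag_group_ospan_sum[OF f x] diag_group_ospan[OF x]
      by (intro sum.cong) (auto simp: scaleC_scaleC mult.commute)
  qed
  show ?thesis
  proof (rule that[OF f N])
    fix x :: 'a and s :: real assume x: "x \<in> F" and s: "\<bar>s\<bar> \<le> b"
    have "norm (?D \<phi> s x - ?D (\<lambda>j. \<theta> (fst j)) s x) \<le> (real p * \<delta>) * \<bar>s\<bar> * norm x"
      by (rule diag_group_perturb[OF f]) (use \<delta> in \<open>auto simp: \<phi>_def intro!: mult_right_mono\<close>)
    also have "\<dots> \<le> (real p * \<delta>) * b * B"
      using B x s \<delta> \<open>0 \<le> b\<close> by (intro mult_mono) auto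
    also have "\<dots> < (real p * \<delta>) * (b + 1) * B"
      using B(1) \<delta> p by simp
    also have "\<dots> = \<epsilon>" using B(1) p \<open>0 \<le> b\<close> by (simp add: \<delta>_def)
    finally show "norm (?D \<phi> s x - diag_group {..<m} e \<theta> s x) < \<epsilon>" by (simp add: unsplit[OF x])
  next
    fix x :: 'a and g :: "'a \<Rightarrow> complex" assume x: "x \<in> F" and g: "g \<in> functional_ball"
    have xe: "x \<in> ospan {..<m} e" using x F by blast
    have "((\<lambda>s. (cmod (g (?D \<phi> s (e k))))\<^sup>2) has_integral N * (\<Sum>l<p. (cmod (a * g (f (k, l))))\<^sup>2)) {0..N}"
      if "k < m" for k
    proof -
      have "g (?D \<phi> s (e k)) = (\<Sum>l<p. (a * g (f (k, l))) * cis ((\<theta> k + real l * \<delta>) * s))" for s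
        by (simp add: De[OF that] functional_ball_sum[OF g] functional_ball_scaleC[OF g] \<phi>_def mult_ac)
      then show ?thesis
        using trig_polynomial_has_integral[OF \<delta>, where z = "\<lambda>l. a * g (f (k, l))" and \<alpha> = "\<theta> k"]
        unfolding N_def by simp
    qed
    then have int: "((\<lambda>s. \<Sum>k<m. (cmod (g (?D \<phi> s (e k))))\<^sup>2) has_integral
        (\<Sum>k<m. N * (\<Sum>l<p. (cmod (a * g (f (k, l))))\<^sup>2))) {0..N}"
      by (intro has_integral_sum) auto
    have bound: "(\<Sum>k<m. N * (\<Sum>l<p. (cmod (a * g (f (k, l))))\<^sup>2)) \<le> real m * (N / real p)"
    proof -
      have "N * (\<Sum>l<p. (cmod (a * g (f (k, l))))\<^sup>2) \<le> N / real p" if "k < m" for k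
      proof -
        have "orthonormal {..<p} (\<lambda>l. f (k, l))"
          using f that by (auto simp: orthonormal_def)
        from functional_ball_bessel[OF g this]
        have "(\<Sum>l<p. (cmod a)\<^sup>2 * (cmod (g (f (k, l))))\<^sup>2) \<le> (cmod a)\<^sup>2"
          unfolding sum_distrib_left[symmetric] by (simp add: mult_left_le)
        also have "(cmod a)\<^sup>2 = 1 / real p" by (simp add: a_def norm_divide power_divide)
        finally show ?thesis
          using N mult_left_mono[of _ "1 / real p" N] by (simp add: norm_mult power_mult_distrib)
      qed
      then have "(\<Sum>k<m. N * (\<Sum>l<p. (cmod (a * g (f (k, l))))\<^sup>2)) \<le> (\<Sum>k<m. N / real p)"
        by (intro sum_mono) auto
      then show ?thesis by simp
    qed
    have "continuous_on {0..N} (\<lambda>s. ?D \<phi> s y)" for y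
      by (rule unitary_group_continuous[OF diag_group_unitary_group[OF f]])
    note cont = functional_ball_continuous[OF g this]
    have "(cmod (g (?D \<phi> s x)))\<^sup>2 \<le> B\<^sup>2 * (\<Sum>k<m. (cmod (g (?D \<phi> s (e k))))\<^sup>2)" for s
    proof -
      have "g (?D \<phi> s x) = (\<Sum>k<m. cinner x (e k) * g (?D \<phi> s (e k)))"
        unfolding diag_group_ospan_sum[OF f xe]
        by (simp add: functional_ball_sum[OF g] functional_ball_scaleC[OF g])
      then have "cmod (g (?D \<phi> s x)) \<le> (\<Sum>k<m. cmod (cinner x (e k)) * cmod (g (?D \<phi> s (e k))))"
        by (simp add: norm_mult[symmetric] norm_sum)
      then have "(cmod (g (?D \<phi> s x)))\<^sup>2 \<le> (\<Sum>k<m. cmod (cinner x (e k)) * cmod (g (?D \<phi> s (e k))))\<^sup>2"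
        by (intro power_mono) auto
      also have "\<dots> \<le> (\<Sum>k<m. (cmod (cinner x (e k)))\<^sup>2) * (\<Sum>k<m. (cmod (g (?D \<phi> s (e k))))\<^sup>2)"
        by (rule Cauchy_Schwarz_ineq_sum)
      also have "(\<Sum>k<m. (cmod (cinner x (e k)))\<^sup>2) \<le> B\<^sup>2"
        unfolding parseval[OF e xe] using B(2)[OF x] by (intro power_mono) auto
      finally show ?thesis by (simp add: mult_right_mono sum_nonneg)
    qed
    then have "integral {0..N} (\<lambda>s. (cmod (g (?D \<phi> s x)))\<^sup>2)
        \<le> integral {0..N} (\<lambda>s. B\<^sup>2 * (\<Sum>k<m. (cmod (g (?D \<phi> s (e k))))\<^sup>2))"
      by (intro integral_le integrable_continuous_interval cont continuous_intros) auto
    also have "\<dots> = B\<^sup>2 * (\<Sum>k<m. N * (\<Sum>l<p. (cmod (a * g (f (k, l))))\<^sup>2))"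
      using has_integral_mult_right[OF int, of "B\<^sup>2"] by (rule integral_unique)
    also have "\<dots> \<le> B\<^sup>2 * (real m * (N / real p))"
      by (intro mult_left_mono bound) simp
    also have "\<dots> = (B\<^sup>2 * real m / real p) * N" by simp
    also have "\<dots> \<le> c * N" using p(2) N by (intro mult_right_mono) auto
    finally show "integral {0..N} (\<lambda>s. (cmod (g (?D \<phi> s x)))\<^sup>2) \<le> c * N" .
  qed
qed

section \<open>Time averages\<close>

text \<open>A bound for the average over one window of length \<open>N\<close>, uniform over all contractive
  functionals, passes to every window \<open>{a..a + N}\<close>, because \<open>g (T (s + a) x) = (g \<circ> T a) (T s x)\<close>
  and \<open>g \<circ> T a\<close> is again contractive. This gives control at all times from information on a
  bounded interval, hence from an open condition on the semigroup.\<close>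

lemma functional_mean_all_times:
  assumes T: "T \<in> isometric_semigroups" and N: "0 < N" and c: "0 \<le> c"
    and window: "\<And>g. g \<in> functional_ball \<Longrightarrow> integral {0..N} (\<lambda>s. (cmod (g (T s x)))\<^sup>2) \<le> c * N"
    and g: "g \<in> functional_ball" and t: "0 \<le> t"
  shows "integral {0..t} (\<lambda>s. (cmod (g (T s x)))\<^sup>2) \<le> c * (t + N)"
proof -
  have cont: "continuous_on {a..b} (\<lambda>s. (cmod (g (T s x)))\<^sup>2)" if "g \<in> functional_ball" "0 \<le> a" for g a b
    using functional_ball_continuous[OF that(1) isometric_semigroup_continuous[OF T]]
    by (rule continuous_on_subset) (use that in auto)
  have windows: "integral {0..real k * N} (\<lambda>s. (cmod (g (T s x)))\<^sup>2) \<le> c * (real k * N)"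
    if "g \<in> functional_ball" for g k
    using that
  proof (induction k arbitrary: g)
    case (Suc k)
    define \<phi> where "\<phi> = (\<lambda>s. (cmod (g (T s x)))\<^sup>2)"
    have TN: "bounded_clinear (T N)" "\<And>y. norm (T N y) = norm y"
      using isometric_semigroup_clinear[OF T] isometric_semigroup_norm[OF T] N by auto
    have "integral {N..real k * N + N} \<phi> = integral {0..real k * N} (\<phi> \<circ> (\<lambda>s. s + N))"
      using integral_shift[of 0 N "real k * N" \<phi>] cont[OF Suc.prems, of N] N by (simp add: \<phi>_def)
    also have "\<dots> = integral {0..real k * N} (\<lambda>s. (cmod (g (T N (T s x))))\<^sup>2)"
      by (rule integral_cong)
        (use N isometric_semigroup_add[OF T, of N] in \<open>simp add: \<phi>_def add.commute\<close>)
    also have "\<dots> \<le> c * (real k * N)"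
      using Suc.IH[OF functional_ball_compose[OF Suc.prems TN]] .
    finally have "integral {N..real k * N + N} \<phi> \<le> c * (real k * N)" .
    moreover have "integral {0..N} \<phi> \<le> c * N" using window[OF Suc.prems] by (simp add: \<phi>_def)
    moreover have "integral {0..N} \<phi> + integral {N..real k * N + N} \<phi> = integral {0..real k * N + N} \<phi>"
      using N cont[OF Suc.prems, of 0]
      by (intro Henstock_Kurzweil_Integration.integral_combine integrable_continuous_interval)
        (auto simp: \<phi>_def)
    ultimately show ?case by (simp add: \<phi>_def algebra_simps)
  qed simp
  define k where "k = nat \<lceil>t / N\<rceil>"
  have "0 \<le> t / N" using t N by simp
  then have "t / N \<le> real k" "real k \<le> t / N + 1" unfolding k_def by linarith+
  then have k: "t \<le> real k * N" "real k * N \<le> t + N" using N by (auto simp: field_simps)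
  have "integral {0..t} (\<lambda>s. (cmod (g (T s x)))\<^sup>2) \<le> integral {0..real k * N} (\<lambda>s. (cmod (g (T s x)))\<^sup>2)"
    using k cont[OF g] by (intro integral_subset_le integrable_continuous_interval) auto
  also have "\<dots> \<le> c * (real k * N)" by (rule windows[OF g])
  also have "\<dots> \<le> c * (t + N)" using k c by (intro mult_left_mono)
  finally show ?thesis .
qed

lemma functional_mean_tendsto_0:
  assumes T: "T \<in> isometric_semigroups" and g: "g \<in> functional_ball"
    and windows: "\<And>n::nat. \<exists>N>0. \<exists>c<1 / real (Suc n). \<forall>g\<in>functional_ball.
      integral {0..N} (\<lambda>s. (cmod (g (T s x)))\<^sup>2) \<le> c * N"
  shows "((\<lambda>t. integral {0..t} (\<lambda>s. (cmod (g (T s x)))\<^sup>2) / t) \<longlongrightarrow> 0) at_top"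
proof (rule tendstoI)
  fix \<epsilon> :: real assume \<epsilon>: "0 < \<epsilon>"
  obtain n where n: "1 / real (Suc n) < \<epsilon> / 2" using nat_approx_posE[of "\<epsilon> / 2"] \<epsilon> by auto
  obtain N c where N: "0 < N" and c: "c < 1 / real (Suc n)"
    and w: "\<forall>g\<in>functional_ball. integral {0..N} (\<lambda>s. (cmod (g (T s x)))\<^sup>2) \<le> c * N"
    using windows[of n] by (elim exE conjE)
  have "(\<lambda>s. (cmod (g (T s x)))\<^sup>2) integrable_on {0..N}"
    by (intro integrable_continuous_interval functional_ball_continuous[OF g]
        continuous_on_subset[OF isometric_semigroup_continuous[OF T]]) auto
  then have "0 \<le> integral {0..N} (\<lambda>s. (cmod (g (T s x)))\<^sup>2)" by (rule integral_nonneg) simp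
  then have "0 \<le> c * N" using bspec[OF w g] by (rule order_trans)
  then have c0: "0 \<le> c" using N by (simp add: zero_le_mult_iff)
  have "\<forall>\<^sub>F t in at_top. max 1 N \<le> (t::real)" by (rule eventually_ge_at_top)
  then show "\<forall>\<^sub>F t in at_top. dist (integral {0..t} (\<lambda>s. (cmod (g (T s x)))\<^sup>2) / t) 0 < \<epsilon>"
  proof eventually_elim
    case (elim t)
    then have t: "0 < t" "N \<le> t" by auto
    have int: "(\<lambda>s. (cmod (g (T s x)))\<^sup>2) integrable_on {0..t}"
      by (intro integrable_continuous_interval functional_ball_continuous[OF g]
          continuous_on_subset[OF isometric_semigroup_continuous[OF T]]) auto
    have "integral {0..t} (\<lambda>s. (cmod (g (T s x)))\<^sup>2) \<le> c * (t + N)"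
      using t by (intro functional_mean_all_times[OF T N c0 bspec[OF w] g]) auto
    also have "\<dots> \<le> c * (2 * t)" using t c0 by (intro mult_left_mono) auto
    also have "\<dots> < \<epsilon> * t" using c n t by simp
    finally have "integral {0..t} (\<lambda>s. (cmod (g (T s x)))\<^sup>2) / t < \<epsilon>"
      using t by (simp add: pos_divide_less_eq)
    moreover have "0 \<le> integral {0..t} (\<lambda>s. (cmod (g (T s x)))\<^sup>2)"
      using int by (rule integral_nonneg) simp
    ultimately show ?case using t by (simp add: dist_real_def)
  qed
qed

section \<open>Convergence along a set of density one\<close>

text \<open>The Koopman--von Neumann lemma. With \<open>a t\<close> a decreasing majorant of the averages, the
  exceptional set consists of the times at which \<open>F\<close> exceeds \<open>sqrt (a t)\<close>. Before time \<open>t\<close> the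
  function then exceeds \<open>sqrt (a t)\<close> there, so Markov's inequality gives the exceptional set
  measure at most \<open>t * a t / sqrt (a t)\<close>.\<close>

lemma koopman_von_neumann:
  fixes F :: "real \<Rightarrow> real"
  assumes cont: "continuous_on {0..} F" and F: "\<And>s. 0 \<le> s \<Longrightarrow> 0 \<le> F s" "\<And>s. 0 \<le> s \<Longrightarrow> F s \<le> 1"
    and mean: "((\<lambda>t. integral {0..t} F / t) \<longlongrightarrow> 0) at_top"
  obtains M where "has_density M 1" "(F \<longlongrightarrow> 0) (inf at_top (principal M))"
proof -
  define A where "A t = integral {0..t} F / t" for t
  have int: "F integrable_on {0..t}" for t
    by (intro integrable_continuous_interval continuous_on_subset[OF cont]) auto
  have A1: "A t \<le> 1" if "1 \<le> t" for t
  proof -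
    have "integral {0..t} F \<le> integral {0..t} (\<lambda>_. 1)"
      using F by (intro integral_le int) auto
    then show ?thesis using that by (simp add: A_def)
  qed
  have A0: "0 \<le> A t" if "1 \<le> t" for t
    unfolding A_def using that F int by (intro divide_nonneg_nonneg integral_nonneg) auto
  \<comment> \<open>The second summand keeps the majorant positive, so that one can divide by it.\<close>
  define a where "a t = (SUP s\<in>{max t 1..}. A s) + 1 / max t 1" for t
  have bdd: "bdd_above (A ` {max t 1..})" for t
    by (rule bdd_aboveI[of _ 1]) (auto intro: A1)
  have A_le: "A t \<le> a t" if "1 \<le> t" for t
  proof -
    have "A t \<le> (SUP s\<in>{max t 1..}. A s)" using that by (intro cSUP_upper bdd) auto
    moreover have "0 \<le> 1 / max t 1" by simp
    ultimately show ?thesis unfolding a_def by linarith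
  qed
  have a_pos: "0 < a t" for t
  proof -
    have "A (max t 1) \<le> (SUP s\<in>{max t 1..}. A s)" by (intro cSUP_upper bdd) auto
    moreover have "0 < 1 / max t 1" "0 \<le> A (max t 1)" by (auto intro: A0)
    ultimately show ?thesis unfolding a_def by linarith
  qed
  have a_anti: "a t \<le> a s" if "s \<le> t" for s t
    unfolding a_def using that
    by (intro add_mono cSUP_subset_mono bdd frac_le) auto
  have a_lim: "(a \<longlongrightarrow> 0) at_top"
  proof (rule tendstoI)
    fix \<epsilon> :: real assume "0 < \<epsilon>"
    have "\<forall>\<^sub>F t in at_top. dist (A t) 0 < \<epsilon> / 3"
      using mean \<open>0 < \<epsilon>\<close> unfolding A_def by (intro tendstoD) auto
    then obtain R where R: "\<And>t. R \<le> t \<Longrightarrow> \<bar>A t\<bar> < \<epsilon> / 3"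
      by (auto simp: eventually_at_top_linorder)
    have "\<forall>\<^sub>F t in at_top. max R (max 1 (3 / \<epsilon>)) \<le> (t::real)" by (rule eventually_ge_at_top)
    then show "\<forall>\<^sub>F t in at_top. dist (a t) 0 < \<epsilon>"
    proof eventually_elim
      case (elim t)
      have "(SUP s\<in>{max t 1..}. A s) \<le> \<epsilon> / 3"
      proof (rule cSUP_least)
        show "A s \<le> \<epsilon> / 3" if "s \<in> {max t 1..}" for s
          using R[of s] that elim by auto
      qed simp
      moreover have "1 / max t 1 \<le> \<epsilon> / 3" using elim \<open>0 < \<epsilon>\<close> by (simp add: field_simps)
      ultimately have "a t \<le> 2 / 3 * \<epsilon>" unfolding a_def by linarith
      then show ?case using a_pos[of t] \<open>0 < \<epsilon>\<close> by (simp add: dist_real_def)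
    qed
  qed
  then have sqrt_lim: "((\<lambda>t. sqrt (a t)) \<longlongrightarrow> 0) at_top"
    using tendsto_real_sqrt by fastforce
  define E where "E = {t. 0 \<le> t \<and> sqrt (a t) < F t}"
  define M where "M = {0..} - E"
  have "mono (\<lambda>t. - a t)" using a_anti by (simp add: mono_def)
  from borel_measurable_uminus[OF borel_measurable_mono[OF this]]
  have a_meas: "a \<in> borel_measurable borel" by simp
  have F_meas: "(\<lambda>t. indicator {0..} t *\<^sub>R F t) \<in> borel_measurable borel"
    by (intro borel_measurable_continuous_on_indicator cont) simp
  have "E = {0..} \<inter> {t \<in> space borel. sqrt (a t) < indicator {0..} t *\<^sub>R F t}"
    by (auto simp: E_def)
  also have "\<dots> \<in> sets borel"
    using a_meas F_meas by (intro sets.Int borel_measurable_less) auto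
  finally have E: "E \<in> sets borel" .
  have E_lm: "E \<inter> {0..t} \<in> lmeasurable" for t
  proof -
    have "{0..t} \<inter> E \<in> lmeasurable"
      by (rule fmeasurable_Int_fmeasurable) (use E in \<open>simp_all add: sets_completionI_sets\<close>)
    then show ?thesis by (simp only: Int_commute)
  qed
  have markov: "measure lebesgue (E \<inter> {0..t}) / t \<le> sqrt (a t)" if t: "1 \<le> t" for t
  proof -
    have "(indicat_real (E \<inter> {0..t}) has_integral measure lebesgue (E \<inter> {0..t})) UNIV"
      using E_lm lmeasurable_iff_indicator_has_integral by blast
    also have "indicat_real (E \<inter> {0..t}) = (\<lambda>s. if s \<in> {0..t} then indicat_real E s else 0)"
      by (auto simp: indicator_def)
    finally have "(indicat_real E has_integral measure lebesgue (E \<inter> {0..t})) {0..t}"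
      by (simp only: has_integral_restrict_UNIV)
    then have "((\<lambda>s. sqrt (a t) * indicat_real E s) has_integral
        sqrt (a t) * measure lebesgue (E \<inter> {0..t})) {0..t}"
      by (rule has_integral_mult_right)
    then have "sqrt (a t) * measure lebesgue (E \<inter> {0..t}) \<le> integral {0..t} F"
    proof (rule has_integral_le[OF _ integrable_integral[OF int]])
      fix s assume s: "s \<in> {0..t}"
      have "sqrt (a t) \<le> F s" if "s \<in> E"
        using that order_trans[of "sqrt (a t)" "sqrt (a s)" "F s"] a_anti[of s t] s
        by (auto simp: E_def)
      then show "sqrt (a t) * indicat_real E s \<le> F s"
        using F(1)[of s] s by (auto simp: indicator_def)
    qed
    also have "\<dots> = t * A t" using t by (simp add: A_def)
    also have "\<dots> \<le> t * a t" using A_le t by simp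
    also have "\<dots> = sqrt (a t) * (t * sqrt (a t))" using a_pos[of t] by simp
    finally have "measure lebesgue (E \<inter> {0..t}) \<le> t * sqrt (a t)"
      using a_pos[of t] by (simp add: mult_le_cancel_left)
    then show ?thesis using t by (simp add: field_simps)
  qed
  have E_lim: "((\<lambda>t. measure lebesgue (E \<inter> {0..t}) / t) \<longlongrightarrow> 0) at_top"
  proof (rule tendsto_sandwich[OF _ _ tendsto_const sqrt_lim])
    show "\<forall>\<^sub>F t in at_top. measure lebesgue (E \<inter> {0..t}) / t \<le> sqrt (a t)"
      using eventually_ge_at_top[of 1] by eventually_elim (rule markov)
    show "\<forall>\<^sub>F t in at_top. 0 \<le> measure lebesgue (E \<inter> {0..t}) / t"
      using eventually_ge_at_top[of 1] by eventually_elim simp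
  qed
  have "((\<lambda>t. 1 - measure lebesgue (E \<inter> {0..t}) / t) \<longlongrightarrow> 1 - 0) at_top"
    by (intro tendsto_intros E_lim)
  moreover have "\<forall>\<^sub>F t in at_top. 1 - measure lebesgue (E \<inter> {0..t}) / t = measure lebesgue (M \<inter> {0..t}) / t"
    using eventually_ge_at_top[of 1]
  proof eventually_elim
    case (elim t)
    have "M \<inter> {0..t} = {0..t} - E \<inter> {0..t}" by (auto simp: M_def)
    then have "measure lebesgue (M \<inter> {0..t}) = t - measure lebesgue (E \<inter> {0..t})"
      using elim E_lm by (simp add: measurable_measure_Diff)
    then show ?case using elim by (simp add: diff_divide_distrib)
  qed
  ultimately have "((\<lambda>t. measure lebesgue (M \<inter> {0..t}) / t) \<longlongrightarrow> 1) at_top"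
    using tendsto_cong by force
  moreover have "M \<in> sets lebesgue" using E by (simp add: M_def sets.Diff)
  ultimately have "has_density M 1" by (auto simp: has_density_def M_def)
  moreover have "(F \<longlongrightarrow> 0) (inf at_top (principal M))"
  proof (rule tendsto_sandwich[OF _ _ tendsto_const])
    show "\<forall>\<^sub>F t in inf at_top (principal M). 0 \<le> F t" "\<forall>\<^sub>F t in inf at_top (principal M). F t \<le> sqrt (a t)"
      unfolding eventually_inf_principal
      by (intro always_eventually; auto simp: M_def E_def F(1) not_less)+
    show "((\<lambda>t. sqrt (a t)) \<longlongrightarrow> 0) (inf at_top (principal M))"
      using sqrt_lim by (rule tendsto_mono[OF inf_le1])
  qed
  ultimately show ?thesis by (rule that)
qed

text \<open>One set of times serves countably many functions: apply the lemma to
  \<open>\<Sum>n. (1 / 2) ^ (n + 1) * f n\<close>.\<close>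

lemma koopman_von_neumann_sequence:
  fixes f :: "nat \<Rightarrow> real \<Rightarrow> real"
  assumes cont: "\<And>n. continuous_on {0..} (f n)"
    and f: "\<And>n s. 0 \<le> s \<Longrightarrow> 0 \<le> f n s" "\<And>n s. 0 \<le> s \<Longrightarrow> f n s \<le> 1"
    and mean: "\<And>n. ((\<lambda>t. integral {0..t} (f n) / t) \<longlongrightarrow> 0) at_top"
  obtains M where "has_density M 1" "\<And>n. (f n \<longlongrightarrow> 0) (inf at_top (principal M))"
proof -
  define h where "h n s = (1 / 2) ^ Suc n * f n s" for n s
  define F where "F s = (\<Sum>n. h n s)" for s
  have h: "0 \<le> h n s" "h n s \<le> (1 / 2) ^ Suc n" "h n s \<le> f n s" if "0 \<le> s" for n s
  proof -
    show "0 \<le> h n s" "h n s \<le> (1 / 2) ^ Suc n"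
      using f[OF that, of n] unfolding h_def by (auto intro: mult_left_le)
    have "(1 / 2) ^ Suc n \<le> (1::real)" by (rule power_le_one) auto
    then show "h n s \<le> f n s" using f(1)[OF that, of n] unfolding h_def by (intro mult_left_le_one_le) auto
  qed
  have geo: "summable (\<lambda>n. (1 / 2) ^ Suc n :: real)" "(\<Sum>n. (1 / 2) ^ Suc n :: real) = 1"
    using power_half_series by (auto simp: sums_iff)
  have summable: "summable (\<lambda>n. h n s)" if "0 \<le> s" for s
    by (rule summable_comparison_test'[OF geo(1), of 0]) (use h that in auto)
  have tail: "F s \<le> (\<Sum>n<k. f n s) + (1 / 2) ^ k" if "0 \<le> s" for s k
  proof -
    have "F s = (\<Sum>n. h (n + k) s) + (\<Sum>n<k. h n s)"
      unfolding F_def by (rule suminf_split_initial_segment[OF summable[OF that]])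
    also have "(\<Sum>n. h (n + k) s) \<le> (\<Sum>n. (1 / 2) ^ k * (1 / 2) ^ Suc n)"
    proof (rule suminf_le)
      show "h (n + k) s \<le> (1 / 2) ^ k * (1 / 2) ^ Suc n" for n
        using h(2)[OF that, of "n + k"] by (simp add: power_add mult_ac)
      show "summable (\<lambda>n. h (n + k) s)" using summable[OF that] by (rule summable_ignore_initial_segment)
      show "summable (\<lambda>n. (1 / 2) ^ k * (1 / 2) ^ Suc n :: real)" using geo(1) by (rule summable_mult)
    qed
    also have "(\<Sum>n. (1 / 2) ^ k * (1 / 2) ^ Suc n :: real) = (1 / 2) ^ k"
      unfolding suminf_mult[OF geo(1)] geo(2) by simp
    also have "(\<Sum>n<k. h n s) \<le> (\<Sum>n<k. f n s)" by (intro sum_mono h that)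
    finally show ?thesis by simp
  qed
  have F0: "0 \<le> F s" "F s \<le> 1" if "0 \<le> s" for s
    using tail[OF that, of 0] suminf_nonneg[OF summable[OF that]] h[OF that] by (auto simp: F_def)
  have "uniform_limit {0..} (\<lambda>k s. \<Sum>n<k. h n s) (\<lambda>s. \<Sum>n. h n s) sequentially"
    by (rule Weierstrass_m_test[OF _ geo(1)]) (use h in auto)
  then have "continuous_on {0..} (\<lambda>s. \<Sum>n. h n s)"
  proof (rule uniform_limit_theorem[rotated])
    show "\<forall>\<^sub>F k in sequentially. continuous_on {0..} (\<lambda>s. \<Sum>n<k. h n s)"
      unfolding h_def by (intro always_eventually allI continuous_intros cont)
  qed simp
  then have F_cont: "continuous_on {0..} F" by (simp add: F_def[abs_def])
  have int: "G integrable_on {0..t}" if "continuous_on {0..} G" for G :: "real \<Rightarrow> real" and t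
    by (intro integrable_continuous_interval continuous_on_subset[OF that]) auto
  have "((\<lambda>t. integral {0..t} F / t) \<longlongrightarrow> 0) at_top"
  proof (rule tendstoI)
    fix \<epsilon> :: real assume "0 < \<epsilon>"
    then obtain k where k: "(1 / 2) ^ k < \<epsilon> / 2"
      using real_arch_pow_inv[of "\<epsilon> / 2" "1 / 2"] by auto
    have "((\<lambda>t. \<Sum>n<k. integral {0..t} (f n) / t) \<longlongrightarrow> (\<Sum>n<k. 0)) at_top"
      by (intro tendsto_sum mean)
    then have "\<forall>\<^sub>F t in at_top. dist (\<Sum>n<k. integral {0..t} (f n) / t) 0 < \<epsilon> / 2"
      using \<open>0 < \<epsilon>\<close> by (intro tendstoD) auto
    with eventually_ge_at_top[of 1] show "\<forall>\<^sub>F t in at_top. dist (integral {0..t} F / t) 0 < \<epsilon>"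
    proof eventually_elim
      case (elim t)
      have "integral {0..t} F \<le> integral {0..t} (\<lambda>s. (\<Sum>n<k. f n s) + (1 / 2) ^ k)"
        by (intro integral_le int F_cont continuous_intros cont tail) auto
      also have "\<dots> = (\<Sum>n<k. integral {0..t} (f n)) + (1 / 2) ^ k * t"
        using elim integral_sum[of "{..<k}" f "{0..t}", OF finite_lessThan int[OF cont]]
        by (subst integral_add) (auto intro!: int continuous_intros cont)
      finally have "integral {0..t} F / t \<le> (\<Sum>n<k. integral {0..t} (f n) / t) + (1 / 2) ^ k"
        using elim by (simp add: sum_divide_distrib[symmetric] field_simps)
      moreover have "0 \<le> integral {0..t} F"
        by (intro integral_nonneg int F_cont) (use F0 in auto)
      ultimately show ?case using elim k by (auto simp: dist_real_def)
    qed
  qed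
  then obtain M where M: "has_density M 1" "(F \<longlongrightarrow> 0) (inf at_top (principal M))"
    using koopman_von_neumann[OF F_cont F0] by blast
  show ?thesis
  proof (rule that[OF M(1)])
    fix n
    have "M \<subseteq> {0..}" using M(1) by (simp add: has_density_def)
    have lim: "((\<lambda>s. 2 ^ Suc n * F s) \<longlongrightarrow> 2 ^ Suc n * 0) (inf at_top (principal M))"
      by (rule tendsto_mult_left[OF M(2)])
    have le: "f n s \<le> 2 ^ Suc n * F s" if "s \<in> M" for s
    proof -
      have s: "0 \<le> s" using that \<open>M \<subseteq> {0..}\<close> by auto
      have "h n s \<le> F s"
        unfolding F_def using sum_le_suminf[OF summable[OF s], of "{n}"] h(1)[OF s] by simp
      have "f n s = (2 * (1 / 2)) ^ Suc n * f n s" by simp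
      also have "\<dots> = 2 ^ Suc n * h n s"
        unfolding h_def power_mult_distrib by (simp only: mult.assoc)
      also have "\<dots> \<le> 2 ^ Suc n * F s" by (rule mult_left_mono[OF \<open>h n s \<le> F s\<close>]) simp
      finally show ?thesis .
    qed
    have nonneg: "\<forall>\<^sub>F s in inf at_top (principal M). 0 \<le> f n s"
      unfolding eventually_inf_principal using f(1) \<open>M \<subseteq> {0..}\<close> by (intro always_eventually) auto
    have upper: "\<forall>\<^sub>F s in inf at_top (principal M). f n s \<le> 2 ^ Suc n * F s"
      unfolding eventually_inf_principal by (intro always_eventually allI impI le)
    have zero: "2 ^ Suc n * 0 = (0::real)" by simp
    show "(f n \<longlongrightarrow> 0) (inf at_top (principal M))"
      by (rule tendsto_sandwich[OF nonneg upper tendsto_const lim[unfolded zero]])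
  qed
qed

text \<open>Small means on some window, for each vector of a dense sequence, suffice: the orbits of these
  vectors are tested against the sequence itself, and the remaining pairs follow by approximation
  because the semigroup is contractive.\<close>

lemma almost_weakly_stable_if_small_means:
  fixes T :: "real \<Rightarrow> 'a::complex_inner \<Rightarrow> 'a" and x :: "nat \<Rightarrow> 'a"
  assumes T: "T \<in> isometric_semigroups"
    and dense: "\<And>y \<epsilon>. 0 < \<epsilon> \<Longrightarrow> \<exists>j. norm (x j - y) < \<epsilon>"
    and windows: "\<And>i n. \<exists>N>0. \<exists>c<1 / real (Suc n). \<forall>g\<in>functional_ball.
      integral {0..N} (\<lambda>s. (cmod (g (T s (x i))))\<^sup>2) \<le> c * N"
  shows "almost_weakly_stable T"
proof -
  \<comment> \<open>The orbit maps tested against the dense sequence, scaled to take values in \<open>{0..1}\<close>.\<close>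
  define z where "z j = complex_of_real (1 / (1 + norm (x j))) *\<^sub>C x j" for j :: nat
  have z: "norm (z j) \<le> 1" for j
    unfolding z_def norm_scaleC norm_of_real by (simp add: divide_le_eq add_pos_nonneg)
  define f where "f i j s = (cmod (cinner (T s (x i)) (z j)))\<^sup>2 / (1 + norm (x i))\<^sup>2" for i j s
  define h where "h k = (case prod_decode k of (i, j) \<Rightarrow> f i j)" for k
  have hf: "h (prod_encode (i, j)) = f i j" for i j by (simp add: h_def)
  have h_cases: "\<exists>i j. h k = f i j" for k
    by (cases "prod_decode k") (auto simp: h_def)
  have g: "(\<lambda>y. cinner y (z j)) \<in> functional_ball" for j by (rule functional_ball_cinner[OF z])
  have f_cont: "continuous_on {0..} (f i j)" for i j
    unfolding f_def using functional_ball_continuous[OF g isometric_semigroup_continuous[OF T]]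
    by (intro continuous_on_divide) (auto simp: add_nonneg_eq_0_iff)
  have f01: "0 \<le> f i j s" "f i j s \<le> 1" if "0 \<le> s" for i j s
  proof -
    show "0 \<le> f i j s" by (simp add: f_def)
    have "cmod (cinner (T s (x i)) (z j)) \<le> 1 + norm (x i)"
      using functional_ball_norm[OF g, of "T s (x i)" j] isometric_semigroup_norm[OF T that, of "x i"]
      by simp
    then have "(cmod (cinner (T s (x i)) (z j)))\<^sup>2 \<le> (1 + norm (x i))\<^sup>2"
      by (intro power_mono) auto
    then show "f i j s \<le> 1" by (simp add: f_def divide_le_eq_1)
  qed
  have f_mean: "((\<lambda>t. integral {0..t} (f i j) / t) \<longlongrightarrow> 0) at_top" for i j
  proof -
    have "((\<lambda>t. integral {0..t} (\<lambda>s. (cmod (cinner (T s (x i)) (z j)))\<^sup>2) / t / (1 + norm (x i))\<^sup>2)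
        \<longlongrightarrow> 0 / (1 + norm (x i))\<^sup>2) at_top"
      by (intro tendsto_divide tendsto_const functional_mean_tendsto_0[OF T g windows])
        (simp add: add_nonneg_eq_0_iff)
    then show ?thesis by (simp add: f_def[abs_def] divide_divide_eq_left mult.commute)
  qed
  obtain M where M: "has_density M 1" and "\<And>k. (h k \<longlongrightarrow> 0) (inf at_top (principal M))"
  proof (rule koopman_von_neumann_sequence[of h])
    fix k s
    obtain i j where k: "h k = f i j" using h_cases by blast
    show "continuous_on {0..} (h k)" "((\<lambda>t. integral {0..t} (h k) / t) \<longlongrightarrow> 0) at_top"
      by (simp_all only: k f_cont f_mean)
    show "0 \<le> h k s" "h k s \<le> 1" if "0 \<le> s" using f01[OF that] by (simp_all add: k)
  qed (rule that)
  then have f_lim: "(f i j \<longlongrightarrow> 0) (inf at_top (principal M))" for i j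
    by (metis hf)
  let ?\<F> = "inf at_top (principal M)"
  have M0: "M \<subseteq> {0..}" using M by (simp add: has_density_def)
  have lim: "((\<lambda>s. cinner (T s (x i)) (x j)) \<longlongrightarrow> 0) ?\<F>" for i j
  proof -
    have "((\<lambda>s. sqrt (f i j s) * ((1 + norm (x i)) * (1 + norm (x j)))) \<longlongrightarrow> sqrt 0 * ((1 + norm (x i)) * (1 + norm (x j)))) ?\<F>"
      by (intro tendsto_mult tendsto_const tendsto_real_sqrt f_lim)
    moreover have "sqrt (f i j s) * ((1 + norm (x i)) * (1 + norm (x j))) = cmod (cinner (T s (x i)) (x j))" for s
    proof -
      have pos: "0 < 1 + norm (x i)" "0 < 1 + norm (x j)" by (simp_all add: add_pos_nonneg)
      have "cmod (cinner (T s (x i)) (z j)) = cmod (cinner (T s (x i)) (x j)) / (1 + norm (x j))"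
        unfolding z_def cinner_scaleC_right norm_mult complex_mod_cnj norm_of_real
        using pos by simp
      then show ?thesis using pos by (simp add: f_def real_sqrt_divide)
    qed
    ultimately have "((\<lambda>s. cmod (cinner (T s (x i)) (x j))) \<longlongrightarrow> 0) ?\<F>" by simp
    then show ?thesis by (rule tendsto_norm_zero_cancel)
  qed
  have "((\<lambda>s. cinner (T s y) w) \<longlongrightarrow> 0) ?\<F>" for y w
  proof (rule tendstoI)
    fix \<epsilon> :: real assume \<epsilon>: "0 < \<epsilon>"
    have "0 < \<epsilon> / (3 * (1 + norm w))" using \<epsilon> by (simp add: add_pos_nonneg)
    then obtain i where i: "norm (x i - y) < \<epsilon> / (3 * (1 + norm w))" using dense by blast
    have "0 < \<epsilon> / (3 * (1 + norm (x i)))" using \<epsilon> by (simp add: add_pos_nonneg)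
    then obtain j where j: "norm (x j - w) < \<epsilon> / (3 * (1 + norm (x i)))" using dense by blast
    have small: "a * b \<le> \<epsilon> / 3" if "a < \<epsilon> / (3 * (1 + b))" "0 \<le> b" for a b
    proof -
      have "a * b \<le> \<epsilon> / (3 * (1 + b)) * b" using that by (intro mult_right_mono) auto
      also have "\<dots> \<le> \<epsilon> / 3" using that \<epsilon> by (simp add: field_simps)
      finally show ?thesis .
    qed
    have "\<forall>\<^sub>F s in ?\<F>. dist (cinner (T s (x i)) (x j)) 0 < \<epsilon> / 3"
      using \<epsilon> by (intro tendstoD[OF lim]) simp
    moreover have "\<forall>\<^sub>F s in ?\<F>. 0 \<le> s"
      unfolding eventually_inf_principal using M0 by (intro always_eventually) auto
    ultimately show "\<forall>\<^sub>F s in ?\<F>. dist (cinner (T s y) w) 0 < \<epsilon>"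
    proof eventually_elim
      case (elim s)
      note Ts = isometric_semigroup_norm[OF T elim(2)]
      have split: "cinner (T s y) w
          = cinner (T s (x i)) (x j) - cinner (T s (x i - y)) w - cinner (T s (x i)) (x j - w)"
        by (simp add: bounded_clinear_diff[OF isometric_semigroup_clinear[OF T elim(2)]]
            cinner_diff_left cinner_diff_right)
      have "cmod (cinner (T s (x i - y)) w) \<le> \<epsilon> / 3"
        using order_trans[OF cmod_cinner_le[of "T s (x i - y)" w], of "\<epsilon> / 3"] small[OF i]
        by (simp add: Ts)
      moreover have "cmod (cinner (T s (x i)) (x j - w)) \<le> \<epsilon> / 3"
        using order_trans[OF cmod_cinner_le[of "T s (x i)" "x j - w"], of "\<epsilon> / 3"] small[OF j]
        by (simp add: Ts mult.commute)
      moreover have "cmod (cinner (T s y) w) \<le> cmod (cinner (T s (x i)) (x j))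
          + cmod (cinner (T s (x i - y)) w) + cmod (cinner (T s (x i)) (x j - w))"
        unfolding split
        by (rule order_trans[OF norm_triangle_ineq4 add_right_mono[OF norm_triangle_ineq4]])
      ultimately show ?case using elim(1) by simp
    qed
  qed
  then show ?thesis
    unfolding almost_weakly_stable_def weak_op_tendsto_def using M by (intro exI[of _ M]) simp
qed

lemma almost_weakly_stable_restrict:
  "almost_weakly_stable (restrict T {0..}) \<longleftrightarrow> almost_weakly_stable T"
proof -
  have "weak_op_tendsto (restrict T {0..}) (\<lambda>x. 0) (inf at_top (principal M))
      \<longleftrightarrow> weak_op_tendsto T (\<lambda>x. 0) (inf at_top (principal M))" if "has_density M 1" for M
  proof -
    have "\<forall>\<^sub>F s in inf at_top (principal M). 0 \<le> s"
      unfolding eventually_inf_principal using that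
      by (intro always_eventually) (auto simp: has_density_def)
    then have "\<forall>\<^sub>F s in inf at_top (principal M). cinner (restrict T {0..} s x) y = cinner (T s x) y" for x y
      by eventually_elim simp
    from tendsto_cong[OF this] show ?thesis unfolding weak_op_tendsto_def by (simp only:)
  qed
  then show ?thesis unfolding almost_weakly_stable_def by blast
qed

section \<open>Residual sets of flows\<close>

text \<open>Each \<open>G \<in> \<G>\<close> contributes one nowhere dense set, the part of the complement of \<open>R\<close> that lies
  outside \<open>G\<close>.\<close>

lemma residual_inI:
  assumes \<G>: "countable \<G>" and op: "\<And>G. G \<in> \<G> \<Longrightarrow> openin Y G"
    and dense: "\<And>G U. G \<in> \<G> \<Longrightarrow> openin Y U \<Longrightarrow> U \<noteq> {} \<Longrightarrow> U \<inter> G \<noteq> {}"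
    and R: "R \<subseteq> topspace Y" and inter: "\<And>S. S \<in> topspace Y \<Longrightarrow> (\<And>G. G \<in> \<G> \<Longrightarrow> S \<in> G) \<Longrightarrow> S \<in> R"
  shows "residual_in Y R"
  unfolding residual_in_def first_category_in_def
proof (intro conjI R exI[of _ "(\<lambda>G. topspace Y - R - G) ` \<G>"] ballI)
  show "countable ((\<lambda>G. topspace Y - R - G) ` \<G>)" using \<G> by simp
  show "topspace Y - R = \<Union> ((\<lambda>G. topspace Y - R - G) ` \<G>)" using inter by auto
  fix N assume "N \<in> (\<lambda>G. topspace Y - R - G) ` \<G>"
  then obtain G where G: "G \<in> \<G>" and N: "N = topspace Y - R - G" by auto
  have "Y closure_of N \<subseteq> topspace Y - G"
    by (rule closure_of_minimal) (use op[OF G] N in auto)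
  then have "Y interior_of (Y closure_of N) \<inter> G = {}"
    using interior_of_subset[of Y "Y closure_of N"] by auto
  then have "Y interior_of (Y closure_of N) = {}"
    using dense[OF G openin_interior_of] by auto
  then show "nowhere_dense_in Y N" using N by (auto simp: nowhere_dense_in_def)
qed

lemma countable_dense_sequence:
  assumes "separable_space (euclidean :: 'a::metric_space topology)"
  obtains x :: "nat \<Rightarrow> 'a::metric_space" where "\<And>y \<epsilon>. 0 < \<epsilon> \<Longrightarrow> \<exists>j. dist (x j) y < \<epsilon>"
proof -
  obtain C :: "'a set" where C: "countable C" "closure C = UNIV"
    using assms by (auto simp: separable_space_def)
  then have "C \<noteq> {}" by auto
  show ?thesis
  proof (rule that)
    show "\<exists>j. dist (from_nat_into C j) y < \<epsilon>" if "0 < \<epsilon>" for y \<epsilon>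
    proof -
      have "y \<in> closure C" using C(2) by simp
      then have "\<exists>c\<in>C. dist c y < \<epsilon>" using that by (simp add: closure_approachable)
      then obtain c where "c \<in> C" "dist c y < \<epsilon>" by blast
      then show ?thesis using from_nat_into_surj[OF C(1)] by metis
    qed
  qed
qed

text \<open>A class of flows that contains all unitary groups, in which every flow is a limit of diagonal
  groups. The two instances are the isometric semigroups and the unitary groups themselves.\<close>

locale flow_class =
  fixes J :: "real set" and X :: "(real \<Rightarrow> 'a::complex_inner \<Rightarrow> 'a) set" and x :: "nat \<Rightarrow> 'a"
  assumes infinite_dim: "\<not> finite_dim TYPE('a::complex_inner)"
    and dense: "0 < \<epsilon> \<Longrightarrow> \<exists>j. norm (x j - y) < \<epsilon>"
    and nonneg_times: "{0..} \<subseteq> J"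
    and clinear: "S \<in> X \<Longrightarrow> t \<in> J \<Longrightarrow> bounded_clinear (S t)"
    and isometry: "S \<in> X \<Longrightarrow> t \<in> J \<Longrightarrow> norm (S t y) = norm y"
    and continuous: "S \<in> X \<Longrightarrow> continuous_on J (\<lambda>t. S t y)"
    and semigroup: "S \<in> X \<Longrightarrow> restrict S {0..} \<in> isometric_semigroups"
    and unitary_flow: "S \<in> unitary_groups \<Longrightarrow> restrict S J \<in> X"
    and diagonal_limit: "T \<in> X \<Longrightarrow> finite F \<Longrightarrow> 0 < \<epsilon> \<Longrightarrow> 0 \<le> b \<Longrightarrow>
      \<exists>m (u :: nat \<Rightarrow> 'a) \<theta>. orthonormal {..<m} u \<and> F \<subseteq> ospan {..<m} u \<and>
        (\<forall>y\<in>F. \<forall>t\<in>J. \<bar>t\<bar> \<le> b \<longrightarrow> norm (diag_group {..<m} u \<theta> t y - T t y) < \<epsilon>)"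
begin

abbreviation "\<T> \<equiv> strong_unif_topology J X"

lemma openin_neighbourhood:
  assumes "finite F" "T \<in> X" "{a..b} \<subseteq> J" "0 < \<epsilon>"
  shows "openin \<T> {S \<in> X. \<forall>y\<in>F. \<forall>t\<in>{a..b}. norm (S t y - T t y) < \<epsilon>}"
  using assms(1)
proof (induction F rule: finite_induct)
  case empty
  then show ?case using openin_topspace[of \<T>] by simp
next
  case (insert y F)
  have "openin \<T> {S \<in> X. \<forall>t\<in>{a..b}. norm (S t y - T t y) < \<epsilon>}"
    unfolding strong_unif_topology_def
    by (rule topology_generated_by_Basis) (use assms in blast)
  from openin_Int[OF this insert.IH]
  show ?case by (rule back_subst[of "openin \<T>"]) auto
qed

text \<open>Neighbourhoods described by the dense sequence: otherwise there would be a sequence outside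
  the open set that converges to one of its points.\<close>

lemma open_contains_neighbourhood:
  assumes U: "openin \<T> U" and T: "T \<in> U"
  obtains m :: nat where "\<And>S. S \<in> X \<Longrightarrow>
    (\<And>j t. j \<le> m \<Longrightarrow> t \<in> J \<Longrightarrow> \<bar>t\<bar> \<le> real m \<Longrightarrow> norm (S t (x j) - T t (x j)) < 1 / real (Suc m)) \<Longrightarrow> S \<in> U"
proof (rule ccontr)
  assume "\<not> thesis"
  define close where "close m S \<longleftrightarrow> (\<forall>j t. j \<le> m \<longrightarrow> t \<in> J \<longrightarrow> \<bar>t\<bar> \<le> real m \<longrightarrow>
      norm (S t (x j) - T t (x j)) < 1 / real (Suc m))" for m S
  have "\<exists>S. S \<in> X \<and> close m S \<and> S \<notin> U" for m
  proof (rule ccontr)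
    assume no: "\<nexists>S. S \<in> X \<and> close m S \<and> S \<notin> U"
    have thesis
    proof (rule that[of m])
      fix S assume "S \<in> X" and "\<And>j t. j \<le> m \<Longrightarrow> t \<in> J \<Longrightarrow> \<bar>t\<bar> \<le> real m
        \<Longrightarrow> norm (S t (x j) - T t (x j)) < 1 / real (Suc m)"
      then have "S \<in> X" "close m S" by (simp_all add: close_def)
      with no show "S \<in> U" by blast
    qed
    with \<open>\<not> thesis\<close> show False by (rule notE)
  qed
  then obtain S where S_all: "\<And>m. S m \<in> X \<and> close m (S m) \<and> S m \<notin> U" by metis
  have SX: "S m \<in> X" and SU: "S m \<notin> U" for m using S_all by simp_all
  have S: "norm (S m t (x j) - T t (x j)) < 1 / real (Suc m)"
    if "j \<le> m" "t \<in> J" "\<bar>t\<bar> \<le> real m" for m j t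
    using S_all[of m] that by (simp add: close_def)
  have TX: "T \<in> X" using openin_subset[OF U] T by auto
  have "limitin \<T> S T sequentially"
  proof (rule iffD2[OF limitin_strong_unif_topology[where J = J and X = X]], rule continuous, assumption,
      intro conjI TX allI impI always_eventually SX)
    fix y a b assume ab: "{a..b} \<subseteq> J"
    show "uniform_limit {a..b} (\<lambda>m t. S m t y) (\<lambda>t. T t y) sequentially"
    proof (rule uniform_limitI)
      fix \<epsilon> :: real assume \<epsilon>: "0 < \<epsilon>"
      obtain j where j: "norm (x j - y) < \<epsilon> / 3" using dense[of "\<epsilon> / 3" y] \<epsilon> by auto
      obtain m0 where m0: "max (max \<bar>a\<bar> \<bar>b\<bar>) (3 / \<epsilon>) \<le> real m0" using real_arch_simple by blast
      show "\<forall>\<^sub>F m in sequentially. \<forall>t\<in>{a..b}. dist (S m t y) (T t y) < \<epsilon>"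
        using eventually_ge_at_top[of "max j m0"]
      proof eventually_elim
        case (elim m)
        have m: "j \<le> m" "\<bar>a\<bar> \<le> real m" "\<bar>b\<bar> \<le> real m" "3 / \<epsilon> \<le> real m"
          using elim m0 by simp_all
        have "1 / real (Suc m) \<le> 1 / (3 / \<epsilon>)"
          using m(4) \<epsilon> by (intro divide_left_mono) (auto intro: mult_pos_pos)
        then have m3: "1 / real (Suc m) \<le> \<epsilon> / 3" by simp
        show ?case
        proof
          fix t assume t: "t \<in> {a..b}"
          then have tJ: "t \<in> J" "\<bar>t\<bar> \<le> real m" using ab m by auto
          have "S m t y - T t y = (S m t (x j) - T t (x j)) - S m t (x j - y) + T t (x j - y)"
            by (simp add: bounded_clinear_diff[OF clinear[OF SX tJ(1)]]
                bounded_clinear_diff[OF clinear[OF TX tJ(1)]])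
          then have "norm (S m t y - T t y)
              \<le> norm (S m t (x j) - T t (x j)) + norm (S m t (x j - y)) + norm (T t (x j - y))"
            using norm_triangle_ineq[of "(S m t (x j) - T t (x j)) - S m t (x j - y)" "T t (x j - y)"]
              norm_triangle_ineq4[of "S m t (x j) - T t (x j)" "S m t (x j - y)"] by simp
          also have "\<dots> < \<epsilon> / 3 + \<epsilon> / 3 + \<epsilon> / 3"
            using S[OF m(1) tJ] m3 j by (simp add: isometry[OF SX tJ(1)] isometry[OF TX tJ(1)])
          finally show "dist (S m t y) (T t y) < \<epsilon>" by (simp add: dist_norm)
        qed
      qed
    qed
  qed
  then have "\<forall>\<^sub>F m in sequentially. S m \<in> U" using U T by (simp add: limitin_def)
  then show False using SU by simp
qed

text \<open>To show a set dense it suffices to perturb diagonal groups into it, since they are dense.\<close>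

lemma dense_if_perturbs_diagonal:
  assumes perturb: "\<And>F (u :: nat \<Rightarrow> 'a) m \<theta> b \<epsilon>. finite F \<Longrightarrow> orthonormal {..<m} u \<Longrightarrow> F \<subseteq> ospan {..<m} u
      \<Longrightarrow> x ` {..n} \<subseteq> F \<Longrightarrow> 0 \<le> b \<Longrightarrow> 0 < \<epsilon>
      \<Longrightarrow> \<exists>S\<in>unitary_groups. restrict S J \<in> G \<and>
        (\<forall>y\<in>F. \<forall>s. \<bar>s\<bar> \<le> b \<longrightarrow> norm (S s y - diag_group {..<m} u \<theta> s y) < \<epsilon>)"
    and U: "openin \<T> U" "U \<noteq> {}"
  shows "U \<inter> G \<noteq> {}"
proof -
  obtain T where T: "T \<in> U" using U by auto
  then have TX: "T \<in> X" using openin_subset[OF U(1)] by auto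
  obtain k :: nat where k: "\<And>S. S \<in> X \<Longrightarrow>
    (\<And>j t. j \<le> k \<Longrightarrow> t \<in> J \<Longrightarrow> \<bar>t\<bar> \<le> real k \<Longrightarrow> norm (S t (x j) - T t (x j)) < 1 / real (Suc k)) \<Longrightarrow> S \<in> U"
    using open_contains_neighbourhood[OF U(1) T] by metis
  define \<epsilon> where "\<epsilon> = 1 / (2 * real (Suc k))"
  have \<epsilon>: "0 < \<epsilon>" "\<epsilon> + \<epsilon> = 1 / real (Suc k)" by (simp_all add: \<epsilon>_def field_simps)
  let ?F = "x ` {..max n k}"
  have "\<exists>m (u :: nat \<Rightarrow> 'a) \<theta>. orthonormal {..<m} u \<and> ?F \<subseteq> ospan {..<m} u \<and>
      (\<forall>y\<in>?F. \<forall>t\<in>J. \<bar>t\<bar> \<le> real k \<longrightarrow> norm (diag_group {..<m} u \<theta> t y - T t y) < \<epsilon>)"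
    by (rule diagonal_limit[OF TX _ \<epsilon>(1)]) auto
  then obtain m and u :: "nat \<Rightarrow> 'a" and \<theta> where u: "orthonormal {..<m} u"
    and F: "?F \<subseteq> ospan {..<m} u"
    and D: "\<forall>y\<in>?F. \<forall>t\<in>J. \<bar>t\<bar> \<le> real k \<longrightarrow> norm (diag_group {..<m} u \<theta> t y - T t y) < \<epsilon>"
    by (elim exE conjE)
  have "\<exists>S\<in>unitary_groups. restrict S J \<in> G \<and>
      (\<forall>y\<in>?F. \<forall>s. \<bar>s\<bar> \<le> real k \<longrightarrow> norm (S s y - diag_group {..<m} u \<theta> s y) < \<epsilon>)"
    by (rule perturb[OF _ u F _ _ \<epsilon>(1)]) auto
  then obtain S where S: "S \<in> unitary_groups" and SG: "restrict S J \<in> G"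
    and SD: "\<forall>y\<in>?F. \<forall>s. \<bar>s\<bar> \<le> real k \<longrightarrow> norm (S s y - diag_group {..<m} u \<theta> s y) < \<epsilon>"
    by (elim bexE conjE)
  have "restrict S J \<in> U"
  proof (rule k[OF unitary_flow[OF S]])
    fix j t assume jt: "j \<le> k" "t \<in> J" "\<bar>t\<bar> \<le> real k"
    then have xj: "x j \<in> ?F" by auto
    have "norm (S t (x j) - T t (x j)) < \<epsilon> + \<epsilon>"
      using norm_triangle_ineq[of "S t (x j) - diag_group {..<m} u \<theta> t (x j)"
          "diag_group {..<m} u \<theta> t (x j) - T t (x j)"]
        D[rule_format, OF xj jt(2,3)] SD[rule_format, OF xj jt(3)] by simp
    then show "norm (restrict S J t (x j) - T t (x j)) < 1 / real (Suc k)" using jt \<epsilon> by simp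
  qed
  then show ?thesis using SG by blast
qed

text \<open>The open dense sets whose intersections force the two properties. Phases \<open>q\<close> from a
  countable dense set are enough, as limit points of a flow form a closed set.\<close>

definition recurrent_flows :: "nat \<Rightarrow> real \<Rightarrow> (real \<Rightarrow> 'a \<Rightarrow> 'a) set" where
  "recurrent_flows n q = {S \<in> X. \<exists>t\<ge>real n. \<forall>j\<le>n. norm (S t (x j) - cis q *\<^sub>C x j) < 1 / real (Suc n)}"

definition mixing_flows :: "nat \<Rightarrow> nat \<Rightarrow> (real \<Rightarrow> 'a \<Rightarrow> 'a) set" where
  "mixing_flows n i = {S \<in> X. \<exists>N>0. \<exists>c<1 / real (Suc n). \<forall>g\<in>functional_ball.
     integral {0..N} (\<lambda>s. (cmod (g (S s (x i))))\<^sup>2) \<le> c * N}"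

lemma open_recurrent_flows: "openin \<T> (recurrent_flows n q)"
proof (subst openin_subopen, rule ballI)
  fix T assume "T \<in> recurrent_flows n q"
  then obtain t where TX: "T \<in> X" and t: "real n \<le> t"
    and T: "\<And>j. j \<le> n \<Longrightarrow> norm (T t (x j) - cis q *\<^sub>C x j) < 1 / real (Suc n)"
    by (auto simp: recurrent_flows_def)
  define \<epsilon> where "\<epsilon> = Min ((\<lambda>j. 1 / real (Suc n) - norm (T t (x j) - cis q *\<^sub>C x j)) ` {..n})"
  have \<epsilon>: "0 < \<epsilon>" using T by (simp add: \<epsilon>_def)
  have \<epsilon>_le: "\<epsilon> \<le> 1 / real (Suc n) - norm (T t (x j) - cis q *\<^sub>C x j)" if "j \<le> n" for j
    unfolding \<epsilon>_def using that by (intro Min_le) auto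
  let ?V = "{S \<in> X. \<forall>y\<in>x ` {..n}. \<forall>s\<in>{t..t}. norm (S s y - T s y) < \<epsilon>}"
  have "openin \<T> ?V"
    using t nonneg_times \<epsilon> by (intro openin_neighbourhood TX) auto
  moreover have "T \<in> ?V" using TX \<epsilon> by simp
  moreover have "?V \<subseteq> recurrent_flows n q"
  proof
    fix S assume S: "S \<in> ?V"
    have "norm (S t (x j) - cis q *\<^sub>C x j) < 1 / real (Suc n)" if "j \<le> n" for j
    proof -
      have "norm (S t (x j) - T t (x j)) < \<epsilon>" using S that by auto
      then show ?thesis
        using norm_triangle_ineq[of "S t (x j) - T t (x j)" "T t (x j) - cis q *\<^sub>C x j"]
          \<epsilon>_le[OF that] by simp
    qed
    then show "S \<in> recurrent_flows n q" using S t by (auto simp: recurrent_flows_def)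
  qed
  ultimately show "\<exists>V. openin \<T> V \<and> T \<in> V \<and> V \<subseteq> recurrent_flows n q" by blast
qed

text \<open>The window is a compact interval, and a change of the flow by \<open>\<epsilon>\<close> on the window changes
  \<open>|g (S s (x i))|\<^sup>2\<close> by at most \<open>2 * norm (x i) * \<epsilon>\<close>, whatever the functional \<open>g\<close>.\<close>

lemma open_mixing_flows: "openin \<T> (mixing_flows n i)"
proof (subst openin_subopen, rule ballI)
  fix T assume "T \<in> mixing_flows n i"
  then obtain N c where TX: "T \<in> X" and N: "0 < N" and c: "c < 1 / real (Suc n)"
    and T: "\<forall>g\<in>functional_ball. integral {0..N} (\<lambda>s. (cmod (g (T s (x i))))\<^sup>2) \<le> c * N"
    unfolding mixing_flows_def mem_Collect_eq by (elim conjE exE)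
  define B where "B = 2 * norm (x i) + 1"
  have B: "0 < B" by (simp add: B_def add_nonneg_pos)
  define w where "w = 1 / real (Suc n)"
  define \<epsilon> where "\<epsilon> = (w - c) / (2 * B)"
  have cw: "c < w" using c by (simp only: w_def)
  then have \<epsilon>: "0 < \<epsilon>" using B by (simp add: \<epsilon>_def)
  have "B * \<epsilon> = (w - c) / 2" using B by (simp add: \<epsilon>_def)
  then have "c + B * \<epsilon> < w" using cw by simp
  then have c': "c + B * \<epsilon> < 1 / real (Suc n)" by (simp only: w_def)
  let ?V = "{S \<in> X. \<forall>y\<in>{x i}. \<forall>s\<in>{0..N}. norm (S s y - T s y) < \<epsilon>}"
  have "openin \<T> ?V"
    using nonneg_times \<epsilon> by (intro openin_neighbourhood TX) auto
  moreover have "T \<in> ?V" using TX \<epsilon> by simp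
  moreover have "?V \<subseteq> mixing_flows n i"
  proof
    fix S assume S: "S \<in> ?V"
    then have SX: "S \<in> X" and ST: "\<And>s. s \<in> {0..N} \<Longrightarrow> norm (S s (x i) - T s (x i)) < \<epsilon>" by auto
    have "integral {0..N} (\<lambda>s. (cmod (g (S s (x i))))\<^sup>2) \<le> (c + B * \<epsilon>) * N"
      if g: "g \<in> functional_ball" for g
    proof -
      have sub: "{0..N} \<subseteq> J" using nonneg_times by auto
      have int: "(\<lambda>s. (cmod (g (R s (x i))))\<^sup>2) integrable_on {0..N}" if "R \<in> X" for R
        by (intro integrable_continuous_interval functional_ball_continuous[OF g]
            continuous_on_subset[OF continuous[OF that] sub])
      have "(cmod (g (S s (x i))))\<^sup>2 \<le> (cmod (g (T s (x i))))\<^sup>2 + B * \<epsilon>" if s: "s \<in> {0..N}" for s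
      proof -
        let ?p = "cmod (g (S s (x i)))" and ?q = "cmod (g (T s (x i)))"
        have sJ: "s \<in> J" using s sub by auto
        have "?p \<le> norm (x i)" "?q \<le> norm (x i)"
          using functional_ball_norm[OF g] isometry[OF SX sJ] isometry[OF TX sJ] by metis+
        then have pq: "?p + ?q \<le> B" by (simp add: B_def)
        have "?p - ?q \<le> cmod (g (S s (x i)) - g (T s (x i)))" by (rule norm_triangle_ineq2)
        also have "\<dots> \<le> norm (S s (x i) - T s (x i))"
          unfolding functional_ball_diff[OF g, symmetric] by (rule functional_ball_norm[OF g])
        also have "\<dots> < \<epsilon>" by (rule ST[OF s])
        finally have "(?p - ?q) * (?p + ?q) \<le> \<epsilon> * B"
          using \<epsilon> pq by (intro mult_mono) auto
        then show ?thesis by (simp add: power2_eq_square algebra_simps)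
      qed
      then have "integral {0..N} (\<lambda>s. (cmod (g (S s (x i))))\<^sup>2)
          \<le> integral {0..N} (\<lambda>s. (cmod (g (T s (x i))))\<^sup>2 + B * \<epsilon>)"
        by (intro integral_le int SX integrable_add TX integrable_const_ivl) auto
      also have "\<dots> = integral {0..N} (\<lambda>s. (cmod (g (T s (x i))))\<^sup>2) + B * \<epsilon> * N"
        using N by (subst integral_add[OF int[OF TX] integrable_const_ivl]) simp
      also have "\<dots> \<le> c * N + B * \<epsilon> * N" using bspec[OF T g] by simp
      finally show ?thesis by (simp add: algebra_simps)
    qed
    then show "S \<in> mixing_flows n i"
      unfolding mixing_flows_def using SX N c' by (intro CollectI conjI exI[of _ N] exI[of _ "c + B * \<epsilon>"]) auto
  qed
  ultimately show "\<exists>V. openin \<T> V \<and> T \<in> V \<and> V \<subseteq> mixing_flows n i" by blast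
qed

lemma dense_recurrent_flows:
  assumes "openin \<T> U" "U \<noteq> {}"
  shows "U \<inter> recurrent_flows n q \<noteq> {}"
proof (rule dense_if_perturbs_diagonal[OF _ assms, of n])
  fix F and u :: "nat \<Rightarrow> 'a" and m \<theta> and b \<epsilon> :: real
  assume F: "finite F" and u: "orthonormal {..<m} u" and Fu: "F \<subseteq> ospan {..<m} u"
    and xF: "x ` {..n} \<subseteq> F" and b: "0 \<le> b" and \<epsilon>: "0 < \<epsilon>"
  obtain \<phi> t where t: "real n \<le> t" "0 \<le> t"
    and rec: "\<And>y. y \<in> F \<Longrightarrow> diag_group {..<m} u \<phi> t y = cis q *\<^sub>C y"
    and close: "\<And>y s. y \<in> F \<Longrightarrow> \<bar>s\<bar> \<le> b \<Longrightarrow> norm (diag_group {..<m} u \<phi> s y - diag_group {..<m} u \<theta> s y) < \<epsilon>"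
    using recurrent_perturbation[OF u F Fu \<epsilon> b norm_cis[of q], of "real n" \<theta>] by metis
  note D = diag_group_unitary_group[OF u, of \<phi>]
  have "t \<in> J" using t(2) nonneg_times by auto
  have "restrict (diag_group {..<m} u \<phi>) J \<in> recurrent_flows n q"
    unfolding recurrent_flows_def
    using t rec xF unitary_flow[OF D] \<open>t \<in> J\<close> by (intro CollectI conjI exI[of _ t]) auto
  then show "\<exists>S\<in>unitary_groups. restrict S J \<in> recurrent_flows n q \<and>
      (\<forall>y\<in>F. \<forall>s. \<bar>s\<bar> \<le> b \<longrightarrow> norm (S s y - diag_group {..<m} u \<theta> s y) < \<epsilon>)"
    using D close by (intro bexI[of _ "diag_group {..<m} u \<phi>"]) auto
qed

lemma dense_mixing_flows:
  assumes "openin \<T> U" "U \<noteq> {}"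
  shows "U \<inter> mixing_flows n i \<noteq> {}"
proof (rule dense_if_perturbs_diagonal[OF _ assms, of i])
  fix F and u :: "nat \<Rightarrow> 'a" and m \<theta> and b \<epsilon> :: real
  assume F: "finite F" and u: "orthonormal {..<m} u" and Fu: "F \<subseteq> ospan {..<m} u"
    and xF: "x ` {..i} \<subseteq> F" and b: "0 \<le> b" and \<epsilon>: "0 < \<epsilon>"
  define c where "c = 1 / (2 * real (Suc n))"
  have c: "0 < c" "c < 1 / real (Suc n)" by (simp_all add: c_def field_simps)
  obtain K and f :: "nat \<times> nat \<Rightarrow> 'a" and \<phi> N where f: "orthonormal K f" and N: "0 < N"
    and close: "\<And>y s. y \<in> F \<Longrightarrow> \<bar>s\<bar> \<le> b \<Longrightarrow> norm (diag_group K f \<phi> s y - diag_group {..<m} u \<theta> s y) < \<epsilon>"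
    and mean: "\<And>y g. y \<in> F \<Longrightarrow> g \<in> functional_ball
      \<Longrightarrow> integral {0..N} (\<lambda>s. (cmod (g (diag_group K f \<phi> s y)))\<^sup>2) \<le> c * N"
    using mixing_perturbation[OF infinite_dim u F Fu \<epsilon> b c(1), of \<theta>] by metis
  note D = diag_group_unitary_group[OF f, of \<phi>]
  have xi: "x i \<in> F" using xF by auto
  have "integral {0..N} (\<lambda>s. (cmod (g (restrict (diag_group K f \<phi>) J s (x i))))\<^sup>2) \<le> c * N"
    if "g \<in> functional_ball" for g
  proof -
    have "integral {0..N} (\<lambda>s. (cmod (g (restrict (diag_group K f \<phi>) J s (x i))))\<^sup>2)
        = integral {0..N} (\<lambda>s. (cmod (g (diag_group K f \<phi> s (x i))))\<^sup>2)"
      using nonneg_times by (intro integral_cong) auto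
    then show ?thesis using mean[OF xi that] by simp
  qed
  then have "restrict (diag_group K f \<phi>) J \<in> mixing_flows n i"
    unfolding mixing_flows_def using N c unitary_flow[OF D]
    by (intro CollectI conjI exI[of _ N] exI[of _ c]) auto
  then show "\<exists>S\<in>unitary_groups. restrict S J \<in> mixing_flows n i \<and>
      (\<forall>y\<in>F. \<forall>s. \<bar>s\<bar> \<le> b \<longrightarrow> norm (S s y - diag_group {..<m} u \<theta> s y) < \<epsilon>)"
    using D close by (intro bexI[of _ "diag_group K f \<phi>"]) auto
qed

lemma mixing_flows_stable:
  assumes S: "S \<in> X" and mix: "\<And>n i. S \<in> mixing_flows n i"
  shows "almost_weakly_stable S"
proof -
  have windows: "\<exists>N>0. \<exists>c<1 / real (Suc n). \<forall>g\<in>functional_ball.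
      integral {0..N} (\<lambda>s. (cmod (g (restrict S {0..} s (x i))))\<^sup>2) \<le> c * N" for i n
  proof -
    have eq: "integral {0..N} (\<lambda>s. (cmod (g (restrict S {0..} s (x i))))\<^sup>2)
        = integral {0..N} (\<lambda>s. (cmod (g (S s (x i))))\<^sup>2)" for N and g :: "'a \<Rightarrow> complex"
      by (intro integral_cong) auto
    show ?thesis unfolding eq using mix[of n i] unfolding mixing_flows_def mem_Collect_eq by (rule conjunct2)
  qed
  have "almost_weakly_stable (restrict S {0..})"
    by (rule almost_weakly_stable_if_small_means[where x = x, OF semigroup[OF S] dense windows])
  then show ?thesis by (simp only: almost_weakly_stable_restrict)
qed

lemma recurrent_flows_unimodular:
  assumes S: "S \<in> X" and rec: "\<And>n q. q \<in> \<rat> \<Longrightarrow> S \<in> recurrent_flows n q"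
  shows "unimodular_limits S"
  unfolding unimodular_limits_def
proof (intro allI impI)
  fix c :: complex assume c: "cmod c = 1"
  have "\<exists>t\<ge>real n. \<forall>j\<le>n. norm (S t (x j) - c *\<^sub>C x j) < 2 / real (Suc n)" for n
  proof -
    obtain B where B: "0 < B" "\<And>y. y \<in> x ` {..n} \<Longrightarrow> norm y \<le> B" 
      using finite_norm_bound[OF finite_imageI[OF finite_atMost]] by metis
    define \<delta> where "\<delta> = 1 / (real (Suc n) * B)"
    have \<delta>: "0 < \<delta>" "\<delta> * B = 1 / real (Suc n)" using B by (simp_all add: \<delta>_def)
    obtain q where q: "q \<in> \<rat>" "Arg c < q" "q < Arg c + \<delta>"
      using Rats_dense_in_real[of "Arg c" "Arg c + \<delta>"] \<delta> by auto
    obtain t where t: "real n \<le> t" and St: "\<forall>j\<le>n. norm (S t (x j) - cis q *\<^sub>C x j) < 1 / real (Suc n)"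
      using rec[OF q(1), of n] unfolding recurrent_flows_def mem_Collect_eq by (elim conjE exE)
    have "cmod (cis q - cis (Arg c)) \<le> 2 * \<bar>(q - Arg c) / 2\<bar>"
      unfolding cmod_cis_diff by (intro mult_left_mono abs_sin_x_le_abs_x) auto
    then have qc: "cmod (cis q - c) \<le> \<delta>" using q by (simp add: cis_Arg_unit[OF c])
    have "norm (S t (x j) - c *\<^sub>C x j) < 2 / real (Suc n)" if "j \<le> n" for j
    proof -
      have "norm ((cis q - c) *\<^sub>C x j) \<le> \<delta> * B"
        unfolding norm_scaleC using qc B \<delta> that by (intro mult_mono) auto
      then show ?thesis
        using St[rule_format, OF that] \<delta>(2) norm_triangle_ineq[of "S t (x j) - cis q *\<^sub>C x j" "(cis q - c) *\<^sub>C x j"]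
        by (simp add: scaleC_diff_left)
    qed
    then show ?thesis using t by (intro exI[of _ t]) auto
  qed
  from choice[OF allI[OF this]] obtain t where
    "\<forall>n. real n \<le> t n \<and> (\<forall>j\<le>n. norm (S (t n) (x j) - c *\<^sub>C x j) < 2 / real (Suc n))" by (rule exE)
  then have t: "real n \<le> t n"
    and St: "j \<le> n \<Longrightarrow> norm (S (t n) (x j) - c *\<^sub>C x j) < 2 / real (Suc n)" for n j by auto
  have t0: "0 \<le> t n" for n using t[of n] by linarith
  then have tJ: "t n \<in> J" for n using nonneg_times by auto
  have "filterlim t at_top sequentially"
    by (rule filterlim_at_top_mono[OF filterlim_real_sequentially]) (simp add: t)
  moreover have "strong_op_tendsto (\<lambda>n. S (t n)) (\<lambda>y. c *\<^sub>C y) sequentially"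
    unfolding strong_op_tendsto_def
  proof (intro allI tendstoI)
    fix y and \<epsilon> :: real assume \<epsilon>: "0 < \<epsilon>"
    obtain j where j: "norm (x j - y) < \<epsilon> / 3" using dense[of "\<epsilon> / 3" y] \<epsilon> by auto
    obtain m0 where m0: "6 / \<epsilon> \<le> real m0" using real_arch_simple by blast
    show "\<forall>\<^sub>F n in sequentially. dist (S (t n) y) (c *\<^sub>C y) < \<epsilon>"
      using eventually_ge_at_top[of "max j m0"]
    proof eventually_elim
      case (elim n)
      then have n: "j \<le> n" "6 / \<epsilon> \<le> real n" using m0 by simp_all
      have "2 / real (Suc n) \<le> 2 / (6 / \<epsilon>)"
        using n(2) \<epsilon> by (intro divide_left_mono) (auto intro: mult_pos_pos)
      then have n3: "2 / real (Suc n) \<le> \<epsilon> / 3" by simp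
      have "S (t n) y - c *\<^sub>C y = (S (t n) (x j) - c *\<^sub>C x j) - S (t n) (x j - y) + c *\<^sub>C (x j - y)"
        by (simp add: bounded_clinear_diff[OF clinear[OF S tJ]] scaleC_diff_right)
      then have "norm (S (t n) y - c *\<^sub>C y)
          \<le> norm (S (t n) (x j) - c *\<^sub>C x j) + norm (S (t n) (x j - y)) + norm (c *\<^sub>C (x j - y))"
        using norm_triangle_ineq[of "(S (t n) (x j) - c *\<^sub>C x j) - S (t n) (x j - y)" "c *\<^sub>C (x j - y)"]
          norm_triangle_ineq4[of "S (t n) (x j) - c *\<^sub>C x j" "S (t n) (x j - y)"] by simp
      also have "\<dots> < \<epsilon> / 3 + \<epsilon> / 3 + \<epsilon> / 3"
        using St[OF n(1)] n3 j c by (simp add: isometry[OF S tJ] norm_scaleC)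
      finally show ?case by (simp add: dist_norm)
    qed
  qed
  ultimately show "\<exists>t. (\<forall>j. 0 \<le> t j) \<and> filterlim t at_top sequentially \<and>
      strong_op_tendsto (\<lambda>j. S (t j)) (\<lambda>y. c *\<^sub>C y) sequentially"
    using t0 by (intro exI[of _ t]) simp
qed

lemma residual_stable_recurrent:
  "residual_in \<T> {S. S \<in> X \<and> almost_weakly_stable S \<and> unimodular_limits S}"
proof (rule residual_inI[where \<G> = "(\<lambda>(n, q). recurrent_flows n q) ` (UNIV \<times> \<rat>)
    \<union> (\<lambda>(n, i). mixing_flows n i) ` UNIV"])
  show "countable ((\<lambda>(n, q). recurrent_flows n q) ` (UNIV \<times> \<rat>) \<union> (\<lambda>(n, i). mixing_flows n i) ` UNIV)"
    by (intro countable_Un countable_image countable_SIGMA countable_rat) auto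
next
  fix S
  assume S: "S \<in> topspace \<T>" and all: "\<And>G. G \<in> (\<lambda>(n, q). recurrent_flows n q) ` (UNIV \<times> \<rat>)
    \<union> (\<lambda>(n, i). mixing_flows n i) ` UNIV \<Longrightarrow> S \<in> G"
  have SX: "S \<in> X" using S by simp
  moreover have "almost_weakly_stable S"
    by (rule mixing_flows_stable[OF SX], rule all) auto
  moreover have "unimodular_limits S"
    by (rule recurrent_flows_unimodular[OF SX], rule all) auto
  ultimately show "S \<in> {S. S \<in> X \<and> almost_weakly_stable S \<and> unimodular_limits S}" by simp
next
  fix G U
  assume "G \<in> (\<lambda>(n, q). recurrent_flows n q) ` (UNIV \<times> \<rat>) \<union> (\<lambda>(n, i). mixing_flows n i) ` UNIV"
    and U: "openin \<T> U" "U \<noteq> {}"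
  then show "U \<inter> G \<noteq> {}"
    using dense_recurrent_flows[OF U] dense_mixing_flows[OF U] by auto
qed (auto simp: open_recurrent_flows open_mixing_flows)

end

theorem theorem4p3:
  assumes "separable_space (euclidean :: 'a::complex_hilbert topology)"
    and "\<not> finite_dim TYPE('a)"
  shows "residual_in I_cont
           {T :: real \<Rightarrow> 'a \<Rightarrow> 'a. T \<in> isometric_semigroups \<and>
              almost_weakly_stable T \<and> unimodular_limits T} \<and>
         residual_in U_cont
           {T :: real \<Rightarrow> 'a \<Rightarrow> 'a. T \<in> unitary_groups \<and>
              almost_weakly_stable T \<and> unimodular_limits T}"
proof -
  obtain x :: "nat \<Rightarrow> 'a" where "\<And>y \<epsilon>. 0 < \<epsilon> \<Longrightarrow> \<exists>j. dist (x j) y < \<epsilon>"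
    using countable_dense_sequence[OF assms(1)] by metis
  then have dense: "\<exists>j. norm (x j - y) < \<epsilon>" if "0 < \<epsilon>" for y \<epsilon>
    using that by (simp add: dist_norm)
  interpret I: flow_class "{0..}" "isometric_semigroups :: (real \<Rightarrow> 'a \<Rightarrow> 'a) set" x
  proof
    show "restrict S {0..} \<in> isometric_semigroups" if "S \<in> isometric_semigroups" for S :: "real \<Rightarrow> 'a \<Rightarrow> 'a"
      using that by (simp add: isometric_semigroups_def C0_semigroup_def extensional_restrict)
    fix T :: "real \<Rightarrow> 'a \<Rightarrow> 'a" and F :: "'a set" and \<epsilon> b :: real
    assume T: "T \<in> isometric_semigroups" and F: "finite F" and \<epsilon>: "0 < \<epsilon>"
    obtain m and u :: "nat \<Rightarrow> 'a" and \<theta> where "orthonormal {..<m} u" "F \<subseteq> ospan {..<m} u"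
      "\<And>y t. y \<in> F \<Longrightarrow> 0 \<le> t \<Longrightarrow> t \<le> b \<Longrightarrow> norm (diag_group {..<m} u \<theta> t y - T t y) < \<epsilon>"
      using semigroup_approx_diag_group[OF T F \<epsilon>, of b] by metis
    then show "\<exists>m (u :: nat \<Rightarrow> 'a) \<theta>. orthonormal {..<m} u \<and> F \<subseteq> ospan {..<m} u \<and>
        (\<forall>y\<in>F. \<forall>t\<in>{0..}. \<bar>t\<bar> \<le> b \<longrightarrow> norm (diag_group {..<m} u \<theta> t y - T t y) < \<epsilon>)"
      by (intro exI[of _ m] exI[of _ u] exI[of _ \<theta>]) auto
  qed (use assms(2) dense in \<open>auto simp: isometric_semigroup_clinear isometric_semigroup_norm
      isometric_semigroup_continuous restrict_unitary_group\<close>)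
  interpret U: flow_class UNIV "unitary_groups :: (real \<Rightarrow> 'a \<Rightarrow> 'a) set" x
  proof
    show "restrict S UNIV \<in> unitary_groups" if "S \<in> unitary_groups" for S :: "real \<Rightarrow> 'a \<Rightarrow> 'a"
      using that by (simp add: restrict_def)
    fix T :: "real \<Rightarrow> 'a \<Rightarrow> 'a" and F :: "'a set" and \<epsilon> b :: real
    assume T: "T \<in> unitary_groups" and F: "finite F" and \<epsilon>: "0 < \<epsilon>" and b: "0 \<le> b"
    obtain m and u :: "nat \<Rightarrow> 'a" and \<theta> where "orthonormal {..<m} u" "F \<subseteq> ospan {..<m} u"
      "\<And>y t. y \<in> F \<Longrightarrow> \<bar>t\<bar> \<le> b \<Longrightarrow> norm (diag_group {..<m} u \<theta> t y - T t y) < \<epsilon>"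
      using group_approx_diag_group[OF T F \<epsilon> b] by metis
    then show "\<exists>m (u :: nat \<Rightarrow> 'a) \<theta>. orthonormal {..<m} u \<and> F \<subseteq> ospan {..<m} u \<and>
        (\<forall>y\<in>F. \<forall>t\<in>UNIV. \<bar>t\<bar> \<le> b \<longrightarrow> norm (diag_group {..<m} u \<theta> t y - T t y) < \<epsilon>)"
      by (intro exI[of _ m] exI[of _ u] exI[of _ \<theta>]) auto
  qed (use assms(2) dense in \<open>auto simp: unitary_group_clinear unitary_group_norm
      unitary_group_continuous restrict_unitary_group\<close>)
  show ?thesis
    using I.residual_stable_recurrent U.residual_stable_recurrent by blast
qed

end
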